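(* Let $k$ be a field. Assigning to each graph $E$ its Leavitt path algebra $L_k(E)$, and to each regular extended path homomorphism $\varphi\colon S(E)\to S(F)$ the map $\varphi_*^L\colon L_k(E)\to L_k(F)$ given by $\varphi_*^L(a+I_E)=\varphi_*^C(a)+I_F$ for $a\in C_k(E)$, defines a covariant functor from $\mathsf{REG}$ to the category $k\text{-}\mathsf{Alg}$ of (not necessarily unital) $k$-algebras and algebra homomorphisms.
   Context: A graph $E=(E^0,E^1,s_E,t_E)$ consists of arbitrary sets $E^0$ (vertices), $E^1$ (edges) and maps $s_E,t_E\colon E^1\to E^0$. A vertex $v$ is regular if $s_E^{-1}(v)$ is finite and nonempty; $\mathrm{reg}(E)$ is the set of regular vertices. $\mathrm{FP}(E)$ is the set of finite paths: vertices (length $0$) and sequences $e_1\ldots e_n$ of edges with $t_E(e_i)=s_E(e_{i+1})$; vertices act as units for concatenation. The graph inverse semigroup is $S(E)=\{(\alpha,\beta)\in \mathrm{FP}(E)^2\mid t_E(\alpha)=t_E(\beta)\}\cup\{0\}$ with $(\alpha,\beta)(\gamma,\delta)=(\alpha\gamma',\delta)$ if $\gamma=\beta\gamma'$, $=(\alpha,\delta\beta')$ if $\beta=\gamma\beta'$, and $=0$ otherwise; $0$ is a zero element. It is an inverse semigroup with $(\alpha,\beta)^*=(\beta,\alpha)$ and natural order $s\le t\iff ss^*t=s$. An extended path homomorphism from $E$ to $F$ is a semigroup homomorphism $\varphi\colon S(E)\to S(F)$ with $\varphi(0)=0$; it is regular if whenever $u\in\mathrm{reg}(E)$, $0\ne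 t\in S(F)$ and $t\le\varphi(u,u)$, there exists $e\in s_E^{-1}(u)$ with $t\varphi(e,e)\neq0$. $\mathsf{REG}$ is the category of graphs and regular extended path homomorphisms, with composition of maps. The Cohn path algebra $C_k(E)$ is the contracted semigroup algebra of $S(E)$ over $k$, i.e. the semigroup algebra $kS(E)$ modulo the ideal spanned by the zero element of $S(E)$; equivalently, the quotient of the path algebra of the extended graph (with an added reversed edge $e^*$ for each edge $e$) by the relations $S_{e^*}S_{e'}=\delta_{e,e'}S_{t_E(e)}$. Write $S_t$ for the class of $t\in S(E)$ (so $S_0=0$), $S_\alpha=S_{(\alpha,t_E(\alpha))}$ and $S_\beta^*=S_{(t_E(\beta),\beta)}$. An extended path homomorphism $\varphi$ induces the algebra homomorphism $\varphi_*^C\colon C_k(E)\to C_k(F)$, $S_t\mapsto S_{\varphi(t)}$. The Leavitt path algebra is $L_k(E)=C_k(E)/I_E$, where $I_E$ is the ideal generated by $\{S_u-\sum_{e\in s_E^{-1}(u)}S_eS_e^*\mid u\in\mathrm{reg}(E)\}$. Part of the assertion is that $\varphi_*^L$ is well defined for regular $\varphi$. *)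

theory Defs
  imports
    "HOL-Algebra.Module"
    "HOL-Algebra.QuotRing"
    "HOL-Library.FuncSet"
    "HOL-Library.Sublist"
    "Graph_Theory.Arc_Walk"
begin

section \<open>Categories and functors\<close>

text \<open>
  Hom-sets are indexed by pairs of objects and need not be disjoint. Identities and composition
  take the objects involved as arguments, so that morphisms can be plain (extensional) maps.
\<close>

record ('o, 'm) category_data =
  Ob :: "'o set"
  Mor :: "'o \<Rightarrow> 'o \<Rightarrow> 'm set"
  Ident :: "'o \<Rightarrow> 'm"
  Comp :: "'o \<Rightarrow> 'o \<Rightarrow> 'o \<Rightarrow> 'm \<Rightarrow> 'm \<Rightarrow> 'm"

locale category =
  fixes C :: "('o, 'm) category_data"
  assumes Ident_Mor: "X \<in> Ob C \<Longrightarrow> Ident C X \<in> Mor C X X"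
    and Comp_Mor: "\<lbrakk>X \<in> Ob C; Y \<in> Ob C; Z \<in> Ob C; f \<in> Mor C X Y; g \<in> Mor C Y Z\<rbrakk>
          \<Longrightarrow> Comp C X Y Z g f \<in> Mor C X Z"
    and Ident_left: "\<lbrakk>X \<in> Ob C; Y \<in> Ob C; f \<in> Mor C X Y\<rbrakk>
          \<Longrightarrow> Comp C X Y Y (Ident C Y) f = f"
    and Ident_right: "\<lbrakk>X \<in> Ob C; Y \<in> Ob C; f \<in> Mor C X Y\<rbrakk>
          \<Longrightarrow> Comp C X X Y f (Ident C X) = f"
    and Comp_assoc: "\<lbrakk>W \<in> Ob C; X \<in> Ob C; Y \<in> Ob C; Z \<in> Ob C;
            f \<in> Mor C W X; g \<in> Mor C X Y; h \<in> Mor C Y Z\<rbrakk>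
          \<Longrightarrow> Comp C W Y Z h (Comp C W X Y g f) = Comp C W X Z (Comp C X Y Z h g) f"

locale covariant_functor =
  source: category C + target: category D
  for C :: "('o, 'm) category_data" and D :: "('p, 'n) category_data" +
  fixes F_ob :: "'o \<Rightarrow> 'p" and F_mor :: "'o \<Rightarrow> 'o \<Rightarrow> 'm \<Rightarrow> 'n"
  assumes F_ob: "X \<in> Ob C \<Longrightarrow> F_ob X \<in> Ob D"
    and F_mor: "\<lbrakk>X \<in> Ob C; Y \<in> Ob C; f \<in> Mor C X Y\<rbrakk>
          \<Longrightarrow> F_mor X Y f \<in> Mor D (F_ob X) (F_ob Y)"
    and F_Ident: "X \<in> Ob C \<Longrightarrow> F_mor X X (Ident C X) = Ident D (F_ob X)"
    and F_Comp: "\<lbrakk>X \<in> Ob C; Y \<in> Ob C; Z \<in> Ob C; f \<in> Mor C X Y; g \<in> Mor C Y Z\<rbrakk>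
          \<Longrightarrow> F_mor X Z (Comp C X Y Z g f)
              = Comp D (F_ob X) (F_ob Y) (F_ob Z) (F_mor Y Z g) (F_mor X Y f)"


section \<open>Graph inverse semigroups\<close>

text \<open>
  A graph is a \<^locale>\<open>wf_digraph\<close>: arbitrary vertex and edge sets, \<^const>\<open>tail\<close> is the source map
  and \<^const>\<open>head\<close> the target map. A finite path is the pair of its source vertex and its list of
  edges; the vertex \<open>v\<close> is the path \<open>(v, [])\<close>.
\<close>

type_synonym ('v, 'e) fpath = "'v \<times> 'e list"

definition FP :: "('v, 'e) pre_digraph \<Rightarrow> ('v, 'e) fpath set" where
  "FP E = {(u, p). \<exists>v. pre_digraph.awalk E u p v}"

definition path_target :: "('v, 'e) pre_digraph \<Rightarrow> ('v, 'e) fpath \<Rightarrow> 'v" where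
  "path_target E \<alpha> = pre_digraph.awlast E (fst \<alpha>) (snd \<alpha>)"

definition vertex_path :: "'v \<Rightarrow> ('v, 'e) fpath" where
  "vertex_path v = (v, [])"

definition edge_path :: "('v, 'e) pre_digraph \<Rightarrow> 'e \<Rightarrow> ('v, 'e) fpath" where
  "edge_path E e = (tail E e, [e])"

definition regular_vertices :: "('v, 'e) pre_digraph \<Rightarrow> 'v set" where
  "regular_vertices E = {v \<in> verts E. finite (out_arcs E v) \<and> out_arcs E v \<noteq> {}}"

datatype ('v, 'e) gis = GZero | GPair "('v, 'e) fpath" "('v, 'e) fpath"

text \<open>
  For paths \<open>\<beta>\<close>, \<open>\<gamma>\<close> of a graph, \<open>\<gamma> = \<beta>\<gamma>'\<close> for some path \<open>\<gamma>'\<close> iff the two have the same source and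
  the edge list of \<open>\<beta>\<close> is a prefix of that of \<open>\<gamma>\<close>; the edge list of \<open>\<gamma>'\<close> is then the remainder.
\<close>

definition path_prefix :: "('v, 'e) fpath \<Rightarrow> ('v, 'e) fpath \<Rightarrow> bool" where
  "path_prefix \<beta> \<gamma> \<longleftrightarrow> fst \<beta> = fst \<gamma> \<and> prefix (snd \<beta>) (snd \<gamma>)"

definition path_rest :: "('v, 'e) fpath \<Rightarrow> ('v, 'e) fpath \<Rightarrow> 'e list" where
  "path_rest \<beta> \<gamma> = drop (length (snd \<beta>)) (snd \<gamma>)"

definition path_append :: "('v, 'e) fpath \<Rightarrow> 'e list \<Rightarrow> ('v, 'e) fpath" where
  "path_append \<alpha> p = (fst \<alpha>, snd \<alpha> @ p)"

fun gis_mult :: "('v, 'e) gis \<Rightarrow> ('v, 'e) gis \<Rightarrow> ('v, 'e) gis" where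
  "gis_mult (GPair \<alpha> \<beta>) (GPair \<gamma> \<delta>) =
    (if path_prefix \<beta> \<gamma> then GPair (path_append \<alpha> (path_rest \<beta> \<gamma>)) \<delta>
     else if path_prefix \<gamma> \<beta> then GPair \<alpha> (path_append \<delta> (path_rest \<gamma> \<beta>))
     else GZero)"
| "gis_mult GZero t = GZero"
| "gis_mult s GZero = GZero"

fun gis_star :: "('v, 'e) gis \<Rightarrow> ('v, 'e) gis" where
  "gis_star GZero = GZero"
| "gis_star (GPair \<alpha> \<beta>) = GPair \<beta> \<alpha>"

text \<open>
  Semigroups are represented by \<^typ>\<open>'a monoid\<close> records, whose unit field is never used
  (\<open>S(E)\<close> has no unit in general).
\<close>

definition gis :: "('v, 'e) pre_digraph \<Rightarrow> ('v, 'e) gis monoid" where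
  "gis E = \<lparr>carrier = {GPair \<alpha> \<beta> |\<alpha> \<beta>.
                \<alpha> \<in> FP E \<and> \<beta> \<in> FP E \<and> path_target E \<alpha> = path_target E \<beta>} \<union> {GZero},
            mult = gis_mult, one = undefined\<rparr>"

definition gis_le :: "('v, 'e) gis \<Rightarrow> ('v, 'e) gis \<Rightarrow> bool" where
  "gis_le s t \<longleftrightarrow> gis_mult (gis_mult s (gis_star s)) t = s"

definition idem :: "('v, 'e) fpath \<Rightarrow> ('v, 'e) gis" where
  "idem \<alpha> = GPair \<alpha> \<alpha>"

text \<open>Maps are taken extensional on their domain, so that equality of morphisms is equality of maps.\<close>

definition ext_path_homs ::
    "('v, 'e) pre_digraph \<Rightarrow> ('w, 'f) pre_digraph \<Rightarrow> (('v, 'e) gis \<Rightarrow> ('w, 'f) gis) set" where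
  "ext_path_homs E F =
    {\<phi> \<in> hom (gis E) (gis F). \<phi> \<in> extensional (carrier (gis E)) \<and> \<phi> GZero = GZero}"

definition regular_hom ::
    "('v, 'e) pre_digraph \<Rightarrow> ('w, 'f) pre_digraph \<Rightarrow> (('v, 'e) gis \<Rightarrow> ('w, 'f) gis) \<Rightarrow> bool" where
  "regular_hom E F \<phi> \<longleftrightarrow>
    (\<forall>u \<in> regular_vertices E. \<forall>t \<in> carrier (gis F).
      t \<noteq> GZero \<and> gis_le t (\<phi> (idem (vertex_path u))) \<longrightarrow>
      (\<exists>e \<in> out_arcs E u. gis_mult t (\<phi> (idem (edge_path E e))) \<noteq> GZero))"

text \<open>
  The types \<open>'v\<close> and \<open>'e\<close> play the role of a universe: the objects are all graphs whose vertices and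
  edges are drawn from them, and both are arbitrary.
\<close>

definition REG ::
    "(('v, 'e) pre_digraph, ('v, 'e) gis \<Rightarrow> ('v, 'e) gis) category_data" where
  "REG = \<lparr>Ob = {E. wf_digraph E},
          Mor = (\<lambda>E F. {\<phi> \<in> ext_path_homs E F. regular_hom E F \<phi>}),
          Ident = (\<lambda>E. \<lambda>t \<in> carrier (gis E). t),
          Comp = (\<lambda>E F G \<psi> \<phi>. compose (carrier (gis E)) \<psi> \<phi>)\<rparr>"


section \<open>Not necessarily unital algebras\<close>

text \<open>
  The \<^const>\<open>one\<close> field of the \<^typ>\<open>('k, 'a) module\<close> record is junk: it is subject to no law and
  not preserved by homomorphisms.
\<close>

locale k_algebra = Module.module K A for K (structure) and A (structure) +
  assumes mult_closed: "\<lbrakk>x \<in> carrier A; y \<in> carrier A\<rbrakk> \<Longrightarrow> x \<otimes>\<^bsub>A\<^esub> y \<in> carrier A"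
    and mult_assoc: "\<lbrakk>x \<in> carrier A; y \<in> carrier A; z \<in> carrier A\<rbrakk>
          \<Longrightarrow> (x \<otimes>\<^bsub>A\<^esub> y) \<otimes>\<^bsub>A\<^esub> z = x \<otimes>\<^bsub>A\<^esub> (y \<otimes>\<^bsub>A\<^esub> z)"
    and mult_l_distr: "\<lbrakk>x \<in> carrier A; y \<in> carrier A; z \<in> carrier A\<rbrakk>
          \<Longrightarrow> (x \<oplus>\<^bsub>A\<^esub> y) \<otimes>\<^bsub>A\<^esub> z = x \<otimes>\<^bsub>A\<^esub> z \<oplus>\<^bsub>A\<^esub> y \<otimes>\<^bsub>A\<^esub> z"
    and mult_r_distr: "\<lbrakk>x \<in> carrier A; y \<in> carrier A; z \<in> carrier A\<rbrakk>
          \<Longrightarrow> z \<otimes>\<^bsub>A\<^esub> (x \<oplus>\<^bsub>A\<^esub> y) = z \<otimes>\<^bsub>A\<^esub> x \<oplus>\<^bsub>A\<^esub> z \<otimes>\<^bsub>A\<^esub> y"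
    and smult_mult_l: "\<lbrakk>c \<in> carrier K; x \<in> carrier A; y \<in> carrier A\<rbrakk>
          \<Longrightarrow> (c \<odot>\<^bsub>A\<^esub> x) \<otimes>\<^bsub>A\<^esub> y = c \<odot>\<^bsub>A\<^esub> (x \<otimes>\<^bsub>A\<^esub> y)"
    and smult_mult_r: "\<lbrakk>c \<in> carrier K; x \<in> carrier A; y \<in> carrier A\<rbrakk>
          \<Longrightarrow> x \<otimes>\<^bsub>A\<^esub> (c \<odot>\<^bsub>A\<^esub> y) = c \<odot>\<^bsub>A\<^esub> (x \<otimes>\<^bsub>A\<^esub> y)"

definition k_algebra_homs ::
    "('k, 'm) ring_scheme \<Rightarrow> ('k, 'a) module \<Rightarrow> ('k, 'b) module \<Rightarrow> ('a \<Rightarrow> 'b) set" where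
  "k_algebra_homs K A B =
    {h \<in> hom A B \<inter> hom (add_monoid A) (add_monoid B). h \<in> extensional (carrier A) \<and>
      (\<forall>c \<in> carrier K. \<forall>x \<in> carrier A. h (c \<odot>\<^bsub>A\<^esub> x) = c \<odot>\<^bsub>B\<^esub> h x)}"

definition k_Alg :: "('k, 'm) ring_scheme \<Rightarrow> (('k, 'a) module, 'a \<Rightarrow> 'a) category_data" where
  "k_Alg K = \<lparr>Ob = {A. k_algebra K A},
              Mor = k_algebra_homs K,
              Ident = (\<lambda>A. \<lambda>x \<in> carrier A. x),
              Comp = (\<lambda>A B D g f. compose (carrier A) g f)\<rparr>"

definition k_ideal :: "('k, 'm) ring_scheme \<Rightarrow> ('k, 'a) module \<Rightarrow> 'a set \<Rightarrow> bool" where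
  "k_ideal K A I \<longleftrightarrow> submodule I K A \<and>
    (\<forall>x \<in> carrier A. \<forall>i \<in> I. x \<otimes>\<^bsub>A\<^esub> i \<in> I \<and> i \<otimes>\<^bsub>A\<^esub> x \<in> I)"

definition k_ideal_gen :: "('k, 'm) ring_scheme \<Rightarrow> ('k, 'a) module \<Rightarrow> 'a set \<Rightarrow> 'a set" where
  "k_ideal_gen K A X = \<Inter>{I. k_ideal K A I \<and> X \<subseteq> I}"

definition k_quotient :: "('k, 'a) module \<Rightarrow> 'a set \<Rightarrow> ('k, 'a set) module" where
  "k_quotient A I =
    \<lparr>carrier = a_rcosets\<^bsub>A\<^esub> I, mult = rcoset_mult A I, one = undefined,
     zero = I, add = set_add A, smult = (\<lambda>c X. \<Union>x\<in>X. I +>\<^bsub>A\<^esub> (c \<odot>\<^bsub>A\<^esub> x))\<rparr>"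

text \<open>
  The map \<open>a + I \<mapsto> h a + J\<close> on quotients induced by \<open>h : A \<rightarrow> B\<close>; meaningful when the coset
  \<open>h a + J\<close> does not depend on the representative \<open>a\<close>.
\<close>

definition quotient_map ::
    "('k, 'a) module \<Rightarrow> 'a set \<Rightarrow> ('k, 'b) module \<Rightarrow> 'b set \<Rightarrow> ('a \<Rightarrow> 'b) \<Rightarrow> 'a set \<Rightarrow> 'b set" where
  "quotient_map A I B J h =
    (\<lambda>X \<in> carrier (k_quotient A I). the_elem ((\<lambda>a. J +>\<^bsub>B\<^esub> h a) ` X))"


section \<open>Semigroup algebras\<close>

text \<open>The elements are the finitely supported functions from the semigroup to \<open>K\<close>.\<close>

definition support ::
    "('k, 'm) ring_scheme \<Rightarrow> ('s, 'n) monoid_scheme \<Rightarrow> ('s \<Rightarrow> 'k) \<Rightarrow> 's set" where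
  "support K S f = {s \<in> carrier S. f s \<noteq> \<zero>\<^bsub>K\<^esub>}"

definition semigroup_algebra ::
    "('k, 'm) ring_scheme \<Rightarrow> ('s, 'n) monoid_scheme \<Rightarrow> ('k, 's \<Rightarrow> 'k) module" where
  "semigroup_algebra K S =
    \<lparr>carrier = {f \<in> carrier S \<rightarrow>\<^sub>E carrier K. finite (support K S f)},
     mult = (\<lambda>f g. \<lambda>t \<in> carrier S.
       \<Oplus>\<^bsub>K\<^esub>p \<in> {p \<in> support K S f \<times> support K S g. fst p \<otimes>\<^bsub>S\<^esub> snd p = t}.
         f (fst p) \<otimes>\<^bsub>K\<^esub> g (snd p)),
     one = undefined,
     zero = (\<lambda>t \<in> carrier S. \<zero>\<^bsub>K\<^esub>),
     add = (\<lambda>f g. \<lambda>t \<in> carrier S. f t \<oplus>\<^bsub>K\<^esub> g t),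
     smult = (\<lambda>c f. \<lambda>t \<in> carrier S. c \<otimes>\<^bsub>K\<^esub> f t)\<rparr>"

definition basis_elem ::
    "('k, 'm) ring_scheme \<Rightarrow> ('s, 'n) monoid_scheme \<Rightarrow> 's \<Rightarrow> 's \<Rightarrow> 'k" where
  "basis_elem K S s = (\<lambda>t \<in> carrier S. if t = s then \<one>\<^bsub>K\<^esub> else \<zero>\<^bsub>K\<^esub>)"

text \<open>The linear extension of \<open>\<phi> : S \<rightarrow> T\<close>, i.e. the linear map sending the basis element of \<open>s\<close> to
  that of \<open>\<phi> s\<close>.\<close>

definition semigroup_algebra_map ::
    "('k, 'm) ring_scheme \<Rightarrow> ('s, 'n) monoid_scheme \<Rightarrow> ('t, 'l) monoid_scheme \<Rightarrow>
      ('s \<Rightarrow> 't) \<Rightarrow> ('s \<Rightarrow> 'k) \<Rightarrow> ('t \<Rightarrow> 'k)" where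
  "semigroup_algebra_map K S T \<phi> =
    (\<lambda>f \<in> carrier (semigroup_algebra K S). \<lambda>t \<in> carrier T.
       \<Oplus>\<^bsub>K\<^esub>s \<in> {s \<in> support K S f. \<phi> s = t}. f s)"


section \<open>Cohn and Leavitt path algebras\<close>

definition zero_span ::
    "('k, 'm) ring_scheme \<Rightarrow> ('v, 'e) pre_digraph \<Rightarrow> (('v, 'e) gis \<Rightarrow> 'k) set" where
  "zero_span K E =
    {c \<odot>\<^bsub>semigroup_algebra K (gis E)\<^esub> basis_elem K (gis E) GZero |c. c \<in> carrier K}"

definition cohn ::
    "('k, 'm) ring_scheme \<Rightarrow> ('v, 'e) pre_digraph \<Rightarrow> ('k, (('v, 'e) gis \<Rightarrow> 'k) set) module" where
  "cohn K E = k_quotient (semigroup_algebra K (gis E)) (zero_span K E)"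

definition cohn_elem ::
    "('k, 'm) ring_scheme \<Rightarrow> ('v, 'e) pre_digraph \<Rightarrow> ('v, 'e) gis \<Rightarrow> (('v, 'e) gis \<Rightarrow> 'k) set" where
  "cohn_elem K E t = zero_span K E +>\<^bsub>semigroup_algebra K (gis E)\<^esub> basis_elem K (gis E) t"

definition cohn_path ::
    "('k, 'm) ring_scheme \<Rightarrow> ('v, 'e) pre_digraph \<Rightarrow> ('v, 'e) fpath \<Rightarrow> (('v, 'e) gis \<Rightarrow> 'k) set" where
  "cohn_path K E \<alpha> = cohn_elem K E (GPair \<alpha> (vertex_path (path_target E \<alpha>)))"

definition cohn_path_star ::
    "('k, 'm) ring_scheme \<Rightarrow> ('v, 'e) pre_digraph \<Rightarrow> ('v, 'e) fpath \<Rightarrow> (('v, 'e) gis \<Rightarrow> 'k) set" where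
  "cohn_path_star K E \<beta> = cohn_elem K E (GPair (vertex_path (path_target E \<beta>)) \<beta>)"

definition cohn_map ::
    "('k, 'm) ring_scheme \<Rightarrow> ('v, 'e) pre_digraph \<Rightarrow> ('w, 'f) pre_digraph \<Rightarrow>
      (('v, 'e) gis \<Rightarrow> ('w, 'f) gis) \<Rightarrow>
      (('v, 'e) gis \<Rightarrow> 'k) set \<Rightarrow> (('w, 'f) gis \<Rightarrow> 'k) set" where
  "cohn_map K E F \<phi> =
    quotient_map (semigroup_algebra K (gis E)) (zero_span K E)
                 (semigroup_algebra K (gis F)) (zero_span K F)
                 (semigroup_algebra_map K (gis E) (gis F) \<phi>)"

definition leavitt_ideal ::
    "('k, 'm) ring_scheme \<Rightarrow> ('v, 'e) pre_digraph \<Rightarrow> (('v, 'e) gis \<Rightarrow> 'k) set set" where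
  "leavitt_ideal K E = k_ideal_gen K (cohn K E)
    {cohn_path K E (vertex_path u) \<ominus>\<^bsub>cohn K E\<^esub>
       (\<Oplus>\<^bsub>cohn K E\<^esub>e \<in> out_arcs E u.
          cohn_path K E (edge_path E e) \<otimes>\<^bsub>cohn K E\<^esub> cohn_path_star K E (edge_path E e))
     |u. u \<in> regular_vertices E}"

definition leavitt ::
    "('k, 'm) ring_scheme \<Rightarrow> ('v, 'e) pre_digraph \<Rightarrow> ('k, (('v, 'e) gis \<Rightarrow> 'k) set set) module" where
  "leavitt K E = k_quotient (cohn K E) (leavitt_ideal K E)"

definition leavitt_map ::
    "('k, 'm) ring_scheme \<Rightarrow> ('v, 'e) pre_digraph \<Rightarrow> ('w, 'f) pre_digraph \<Rightarrow>
      (('v, 'e) gis \<Rightarrow> ('w, 'f) gis) \<Rightarrow>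
      (('v, 'e) gis \<Rightarrow> 'k) set set \<Rightarrow> (('w, 'f) gis \<Rightarrow> 'k) set set" where
  "leavitt_map K E F \<phi> =
    quotient_map (cohn K E) (leavitt_ideal K E) (cohn K F) (leavitt_ideal K F) (cohn_map K E F \<phi>)"

end

theory Submission
  imports Defs
begin

text \<open>
  Everything rests on the shape of a regular homomorphism \<open>\<phi>\<close> at a regular vertex \<open>u\<close>. If
  \<open>\<phi>(u, u)\<close> is not \<open>0\<close>, it is an idempotent \<open>(\<beta>, \<beta>)\<close>, and the nonzero ones among the \<open>\<phi>(e, e)\<close> are
  pairwise orthogonal idempotents \<open>(\<xi>, \<xi>)\<close> with \<open>\<xi>\<close> extending \<open>\<beta>\<close>. Regularity says that every
  extension of \<open>\<beta>\<close> is comparable with one of these finitely many \<open>\<xi>\<close>, and hence the \<open>\<xi>\<close> are the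
  leaves of a finite tree with root \<open>\<beta>\<close> that branches only at regular vertices, along all their edges.
  Induction on the tree gives both that regularity survives composition and that
  \<open>S\<^sub>\<beta>S\<^sub>\<beta>\<^sup>*\<close> is the sum of the \<open>S\<^sub>\<xi>S\<^sub>\<xi>\<^sup>*\<close> modulo the Leavitt ideal, so that \<open>\<phi>\<close> respects the ideals.
\<close>

section \<open>Quotients of algebras\<close>

text \<open>The obstacle to composing: regularity of \<psi> speaks only of regular vertices of the
  middle graph, whereas \<phi> takes a vertex u to the idempotent of an arbitrary path \<beta>, and
  an edge at u to 0 or to the idempotent of an extension of \<beta> by any number of edges. The gap
  between \<beta> and these extensions has to be filled one edge at a time, and \<open>cover\<close>
  records how. The Leavitt relations, also given at vertices only, meet the same gap. At a branching
  path \<beta> with target v, the elements (\<beta>, v) and (v, \<beta>) carry statements about (v,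
  v) to statements about (\<beta>, \<beta>); both inductions on the tree rest on this. A cover is a
  set of paths, while the relation at u is a sum over edges. Orthogonality is therefore used twice:
  to make the leaves incomparable, and to exclude that two edges have the same nonzero image. If
  \<phi>(u, u) = 0, then every \<phi>(e, e) = \<phi>(u, u)\<phi>(e, e) vanishes as well and the
  relation at u goes to 0 = 0.\<close>

context k_algebra
begin

lemma mult_zero_left: "x \<in> carrier A \<Longrightarrow> \<zero>\<^bsub>A\<^esub> \<otimes>\<^bsub>A\<^esub> x = \<zero>\<^bsub>A\<^esub>"
  using smult_mult_l[of \<zero> "\<zero>\<^bsub>A\<^esub>" x] mult_closed by simp

lemma mult_zero_right: "x \<in> carrier A \<Longrightarrow> x \<otimes>\<^bsub>A\<^esub> \<zero>\<^bsub>A\<^esub> = \<zero>\<^bsub>A\<^esub>"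
  using smult_mult_r[of \<zero> x "\<zero>\<^bsub>A\<^esub>"] mult_closed by simp

lemma mult_finsum_right:
  assumes "finite J" "x \<in> carrier A" "f \<in> J \<rightarrow> carrier A"
  shows "x \<otimes>\<^bsub>A\<^esub> (\<Oplus>\<^bsub>A\<^esub>j\<in>J. f j) = (\<Oplus>\<^bsub>A\<^esub>j\<in>J. x \<otimes>\<^bsub>A\<^esub> f j)"
  using assms
  by (induction J rule: finite_induct)
    (simp_all add: mult_zero_right Pi_def mult_r_distr mult_closed)

lemma mult_finsum_left:
  assumes "finite J" "x \<in> carrier A" "f \<in> J \<rightarrow> carrier A"
  shows "(\<Oplus>\<^bsub>A\<^esub>j\<in>J. f j) \<otimes>\<^bsub>A\<^esub> x = (\<Oplus>\<^bsub>A\<^esub>j\<in>J. f j \<otimes>\<^bsub>A\<^esub> x)"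
  using assms
  by (induction J rule: finite_induct)
    (simp_all add: mult_zero_left Pi_def mult_l_distr mult_closed)

end

text \<open>Fixes the type of \<open>A\<close> to the plain record \<open>('k, 'a) module\<close>,
  at which \<open>k_ideal\<close>, \<open>k_quotient\<close> and \<open>quotient_map\<close> are
  stated.\<close>

locale nonunital_algebra = k_algebra K A
  for K :: "('k, 'm) ring_scheme" (structure) and A :: "('k, 'a) module" (structure)
begin

lemma k_idealI:
  assumes "I \<subseteq> carrier A" "\<zero>\<^bsub>A\<^esub> \<in> I"
    and "\<And>x y. x \<in> I \<Longrightarrow> y \<in> I \<Longrightarrow> x \<oplus>\<^bsub>A\<^esub> y \<in> I"
    and smult: "\<And>c x. c \<in> carrier K \<Longrightarrow> x \<in> I \<Longrightarrow> c \<odot>\<^bsub>A\<^esub> x \<in> I"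
    and "\<And>x i. x \<in> carrier A \<Longrightarrow> i \<in> I \<Longrightarrow> x \<otimes>\<^bsub>A\<^esub> i \<in> I"
    and "\<And>x i. x \<in> carrier A \<Longrightarrow> i \<in> I \<Longrightarrow> i \<otimes>\<^bsub>A\<^esub> x \<in> I"
  shows "k_ideal K A I"
proof -
  \<comment> \<open>Closure under negation is not among the assumptions; it comes from the scalar
    -1.\<close>
  have "\<ominus>\<^bsub>A\<^esub> x \<in> I" if "x \<in> I" for x
    using smult[of "\<ominus> \<one>" x] that assms(1) by (simp add: smult_l_minus subset_iff)
  with assms show ?thesis
    by (auto simp: k_ideal_def intro!: submoduleI)
qed

lemma k_ideal_carrier: "k_ideal K A (carrier A)"
  by (auto intro: k_idealI mult_closed)

lemma k_ideal_gen:
  assumes "X \<subseteq> carrier A"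
  shows k_ideal_k_ideal_gen: "k_ideal K A (k_ideal_gen K A X)"
    and k_ideal_gen_superset: "X \<subseteq> k_ideal_gen K A X"
proof -
  define F where "F = {I. k_ideal K A I \<and> X \<subseteq> I}"
  then have gen: "k_ideal_gen K A X = \<Inter>F"
    by (simp add: k_ideal_gen_def)
  \<comment> \<open>The family is not empty, so its intersection stays inside the carrier.\<close>
  have F: "carrier A \<in> F"
    using assms k_ideal_carrier by (simp add: F_def)
  have I: "\<zero>\<^bsub>A\<^esub> \<in> I" "\<And>x y. x \<in> I \<Longrightarrow> y \<in> I \<Longrightarrow> x \<oplus>\<^bsub>A\<^esub> y \<in> I"
    "\<And>c x. c \<in> carrier K \<Longrightarrow> x \<in> I \<Longrightarrow> c \<odot>\<^bsub>A\<^esub> x \<in> I"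
    "\<And>x i. x \<in> carrier A \<Longrightarrow> i \<in> I \<Longrightarrow> x \<otimes>\<^bsub>A\<^esub> i \<in> I"
    "\<And>x i. x \<in> carrier A \<Longrightarrow> i \<in> I \<Longrightarrow> i \<otimes>\<^bsub>A\<^esub> x \<in> I" if "I \<in> F" for I
  proof -
    have "submodule I K A"
      using that by (simp add: F_def k_ideal_def)
    then interpret I: submodule I K A .
    show "\<zero>\<^bsub>A\<^esub> \<in> I" "\<And>x y. x \<in> I \<Longrightarrow> y \<in> I \<Longrightarrow> x \<oplus>\<^bsub>A\<^esub> y \<in> I"
      "\<And>c x. c \<in> carrier K \<Longrightarrow> x \<in> I \<Longrightarrow> c \<odot>\<^bsub>A\<^esub> x \<in> I"
      using I.one_closed I.m_closed I.smult_closed by simp_all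
    show "\<And>x i. x \<in> carrier A \<Longrightarrow> i \<in> I \<Longrightarrow> x \<otimes>\<^bsub>A\<^esub> i \<in> I"
      "\<And>x i. x \<in> carrier A \<Longrightarrow> i \<in> I \<Longrightarrow> i \<otimes>\<^bsub>A\<^esub> x \<in> I"
      using that by (simp_all add: F_def k_ideal_def)
  qed
  show "k_ideal K A (k_ideal_gen K A X)"
    unfolding gen
  proof (rule k_idealI)
    show "\<Inter>F \<subseteq> carrier A"
      using F by blast
  qed (blast intro: I)+
  show "X \<subseteq> k_ideal_gen K A X"
    unfolding k_ideal_gen_def by blast
qed

end

locale k_algebra_ideal = nonunital_algebra +
  fixes I
  assumes ideal: "k_ideal K A I"
begin

sublocale abelian_subgroup I A
  using ideal M.abelian_group_axioms
  by (intro abelian_subgroupI3) (auto simp: k_ideal_def submodule_def additive_subgroup_def)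

lemma ideal_mult_left: "x \<in> carrier A \<Longrightarrow> i \<in> I \<Longrightarrow> x \<otimes>\<^bsub>A\<^esub> i \<in> I"
  and ideal_mult_right: "x \<in> carrier A \<Longrightarrow> i \<in> I \<Longrightarrow> i \<otimes>\<^bsub>A\<^esub> x \<in> I"
  and ideal_smult: "c \<in> carrier K \<Longrightarrow> i \<in> I \<Longrightarrow> c \<odot>\<^bsub>A\<^esub> i \<in> I"
  using ideal by (auto simp: k_ideal_def submodule.smult_closed)

abbreviation coset where "coset a \<equiv> I +>\<^bsub>A\<^esub> a"

lemma coset_self: "a \<in> carrier A \<Longrightarrow> a \<in> coset a"
  by (rule a_rcos_self)

lemma coset_cong: "i \<in> I \<Longrightarrow> a \<in> carrier A \<Longrightarrow> coset (i \<oplus>\<^bsub>A\<^esub> a) = coset a"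
  by (metis M.a_coset_add_assoc a_Hcarr a_rcos_const a_subset)

lemma cosetE:
  assumes "b \<in> coset a" "a \<in> carrier A"
  obtains i where "i \<in> I" "b = i \<oplus>\<^bsub>A\<^esub> a"
  using assms by (auto simp: a_r_coset_def')

lemma coset_eq_iff_minus:
  assumes "a \<in> carrier A" "b \<in> carrier A"
  shows "coset a = coset b \<longleftrightarrow> a \<ominus>\<^bsub>A\<^esub> b \<in> I"
  unfolding a_minus_def
  by (metis a_rcos_module a_repr_independence' assms coset_self)

lemma carrier_k_quotient: "carrier (k_quotient A I) = coset ` carrier A"
  by (auto simp: k_quotient_def A_RCOSETS_def')

lemma coset_closed: "a \<in> carrier A \<Longrightarrow> coset a \<in> carrier (k_quotient A I)"
  by (simp add: carrier_k_quotient)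

lemma zero_k_quotient: "\<zero>\<^bsub>k_quotient A I\<^esub> = coset \<zero>\<^bsub>A\<^esub>"
  using a_subset by (simp add: k_quotient_def)

lemma coset_eq_zero_iff: "a \<in> carrier A \<Longrightarrow> coset a = \<zero>\<^bsub>k_quotient A I\<^esub> \<longleftrightarrow> a \<in> I"
  using a_rcos_const coset_self by (auto simp: k_quotient_def)

lemma add_coset:
  assumes "a \<in> carrier A" "b \<in> carrier A"
  shows "coset a \<oplus>\<^bsub>k_quotient A I\<^esub> coset b = coset (a \<oplus>\<^bsub>A\<^esub> b)"
  using assms by (simp add: k_quotient_def a_rcos_sum)

text \<open>\<open>rcoset_mult\<close> is a union over all pairs of representatives. It collapses to
  one coset because, for x = i + a and y = j + b with i, j in \<open>I\<close>, the product xy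
  differs from ab by iy + aj, which a two-sided ideal contains.\<close>

lemma mult_coset:
  assumes a: "a \<in> carrier A" and b: "b \<in> carrier A"
  shows "coset a \<otimes>\<^bsub>k_quotient A I\<^esub> coset b = coset (a \<otimes>\<^bsub>A\<^esub> b)"
proof -
  have "coset (x \<otimes>\<^bsub>A\<^esub> y) = coset (a \<otimes>\<^bsub>A\<^esub> b)" if xy: "x \<in> coset a" "y \<in> coset b" for x y
  proof -
    obtain i j where i: "i \<in> I" "x = i \<oplus>\<^bsub>A\<^esub> a" and j: "j \<in> I" "y = j \<oplus>\<^bsub>A\<^esub> b"
      by (meson a b cosetE xy)
    have ij: "i \<in> carrier A" "j \<in> carrier A"
      using i j by auto
    have "x \<otimes>\<^bsub>A\<^esub> y = (i \<otimes>\<^bsub>A\<^esub> y \<oplus>\<^bsub>A\<^esub> a \<otimes>\<^bsub>A\<^esub> j) \<oplus>\<^bsub>A\<^esub> a \<otimes>\<^bsub>A\<^esub> b"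
      using ij a b i(2) j(2) by (simp add: mult_l_distr mult_r_distr mult_closed M.a_ac)
    moreover have "i \<otimes>\<^bsub>A\<^esub> y \<oplus>\<^bsub>A\<^esub> a \<otimes>\<^bsub>A\<^esub> j \<in> I"
      using i j a b by (simp add: ideal_mult_left ideal_mult_right)
    ultimately show ?thesis
      by (simp only: coset_cong a b mult_closed)
  qed
  then show ?thesis
    unfolding k_quotient_def rcoset_mult_def monoid.simps
    by (intro ballI UN_constant_eq[OF coset_self[OF a]] UN_constant_eq[OF coset_self[OF b]])
qed

lemma smult_coset:
  assumes c: "c \<in> carrier K" and a: "a \<in> carrier A"
  shows "c \<odot>\<^bsub>k_quotient A I\<^esub> coset a = coset (c \<odot>\<^bsub>A\<^esub> a)"
proof -
  have "coset (c \<odot>\<^bsub>A\<^esub> x) = coset (c \<odot>\<^bsub>A\<^esub> a)" if "x \<in> coset a" for x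
  proof -
    obtain i where "i \<in> I" "x = i \<oplus>\<^bsub>A\<^esub> a"
      using \<open>x \<in> coset a\<close> a by (rule cosetE)
    then have "c \<odot>\<^bsub>A\<^esub> x = c \<odot>\<^bsub>A\<^esub> i \<oplus>\<^bsub>A\<^esub> c \<odot>\<^bsub>A\<^esub> a" "c \<odot>\<^bsub>A\<^esub> i \<in> I"
      using a c by (simp_all add: smult_r_distr ideal_smult)
    then show ?thesis
      by (simp only: coset_cong a c smult_closed)
  qed
  then show ?thesis
    unfolding k_quotient_def module.simps by (intro ballI UN_constant_eq[OF coset_self[OF a]])
qed

lemmas coset_ops = add_coset mult_coset smult_coset

lemma k_algebra_k_quotient: "k_algebra K (k_quotient A I)"
proof -
  have grp: "abelian_group (k_quotient A I)"
  proof (rule abelian_groupI)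
    fix x assume "x \<in> carrier (k_quotient A I)"
    then obtain a where "a \<in> carrier A" "x = coset a"
      by (auto simp: carrier_k_quotient)
    then show "\<exists>y\<in>carrier (k_quotient A I). y \<oplus>\<^bsub>k_quotient A I\<^esub> x = \<zero>\<^bsub>k_quotient A I\<^esub>"
      by (intro bexI[of _ "coset (\<ominus>\<^bsub>A\<^esub> a)"])
        (simp_all add: add_coset zero_k_quotient coset_closed M.l_neg)
  qed (auto simp: carrier_k_quotient zero_k_quotient add_coset M.a_ac)
  have "Module.module K (k_quotient A I)"
    by (rule moduleI[OF R.is_cring grp])
      (auto simp: carrier_k_quotient coset_ops smult_l_distr smult_r_distr smult_assoc1)
  then show ?thesis
    unfolding k_algebra_def k_algebra_axioms_def
    by (auto simp: carrier_k_quotient coset_ops mult_closed mult_assoc mult_l_distr mult_r_distr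
        smult_mult_l smult_mult_r)
qed

end

section \<open>Algebra homomorphisms\<close>

locale k_algebra_hom = dom: nonunital_algebra K A + cod: nonunital_algebra K B
  for K (structure) and A and B +
  fixes h
  assumes hom_closed: "x \<in> carrier A \<Longrightarrow> h x \<in> carrier B"
    and hom_mult: "\<lbrakk>x \<in> carrier A; y \<in> carrier A\<rbrakk> \<Longrightarrow> h (x \<otimes>\<^bsub>A\<^esub> y) = h x \<otimes>\<^bsub>B\<^esub> h y"
    and hom_add: "\<lbrakk>x \<in> carrier A; y \<in> carrier A\<rbrakk> \<Longrightarrow> h (x \<oplus>\<^bsub>A\<^esub> y) = h x \<oplus>\<^bsub>B\<^esub> h y"
    and hom_smult: "\<lbrakk>c \<in> carrier K; x \<in> carrier A\<rbrakk> \<Longrightarrow> h (c \<odot>\<^bsub>A\<^esub> x) = c \<odot>\<^bsub>B\<^esub> h x"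
begin

sublocale abelian_group_hom A B h
  by (rule abelian_group_homI)
    (auto simp: hom_closed hom_add dom.M.abelian_group_axioms cod.M.abelian_group_axioms
      intro!: group_hom.intro group_hom_axioms.intro homI dom.M.a_group cod.M.a_group)

lemma hom_minus:
  "x \<in> carrier A \<Longrightarrow> y \<in> carrier A \<Longrightarrow> h (x \<ominus>\<^bsub>A\<^esub> y) = h x \<ominus>\<^bsub>B\<^esub> h y"
  by (simp add: a_minus_def hom_add)

lemma hom_finsum:
  assumes "finite J" "f \<in> J \<rightarrow> carrier A"
  shows "h (\<Oplus>\<^bsub>A\<^esub>j\<in>J. f j) = (\<Oplus>\<^bsub>B\<^esub>j\<in>J. h (f j))"
  using assms
  by (induction J rule: finite_induct) (simp_all add: Pi_def hom_closed hom_add)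

lemma k_ideal_vimage:
  assumes "k_ideal K B J"
  shows "k_ideal K A {x \<in> carrier A. h x \<in> J}"
proof -
  interpret J: k_algebra_ideal K B J
    by unfold_locales (rule assms)
  show ?thesis
    by (rule dom.k_idealI)
      (auto simp: dom.mult_closed hom_mult hom_smult J.ideal_mult_left J.ideal_mult_right
        J.ideal_smult hom_closed)
qed

text \<open>The image of an ideal need not be an ideal when \<open>h\<close> is not onto. The
  preimage of \<open>J\<close> is one, and it contains \<open>X\<close>, hence the ideal generated
  by \<open>X\<close>.\<close>

lemma image_k_ideal_gen_subset:
  assumes "k_ideal K B J" "X \<subseteq> carrier A" "h ` X \<subseteq> J"
  shows "h ` k_ideal_gen K A X \<subseteq> J"
  using k_ideal_vimage[OF assms(1)] assms(2,3) unfolding k_ideal_gen_def by blast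

lemma extensional_in_k_algebra_homs:
  assumes "h \<in> extensional (carrier A)"
  shows "h \<in> k_algebra_homs K A B"
  using assms by (auto simp: k_algebra_homs_def hom_def hom_closed hom_mult hom_add hom_smult)

end

lemma nonunital_algebra_iff: "nonunital_algebra K A \<longleftrightarrow> k_algebra K A"
  by (simp add: nonunital_algebra_def)

lemma k_algebra_homs_imp_k_algebra_hom:
  assumes "k_algebra K A" "k_algebra K B" "h \<in> k_algebra_homs K A B"
  shows "k_algebra_hom K A B h"
  using assms
  by (auto simp: k_algebra_hom_def k_algebra_hom_axioms_def nonunital_algebra_iff k_algebra_homs_def hom_def Pi_iff)

lemma (in k_algebra_hom) k_algebra_hom_comp:
  assumes "k_algebra_hom K B D g"
  shows "k_algebra_hom K A D (\<lambda>x. g (h x))"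
proof -
  interpret g: k_algebra_hom K B D g by fact
  show ?thesis
    by unfold_locales (simp_all add: hom_closed hom_mult hom_smult g.hom_closed g.hom_mult
        g.hom_smult)
qed

lemma (in k_algebra_hom) k_algebra_hom_cong:
  assumes "\<And>x. x \<in> carrier A \<Longrightarrow> g x = h x"
  shows "k_algebra_hom K A B g"
  by unfold_locales
    (simp_all add: assms hom_closed hom_mult hom_smult dom.mult_closed)

lemma (in k_algebra_ideal) k_algebra_hom_coset: "k_algebra_hom K A (k_quotient A I) coset"
  using k_algebra_k_quotient k_algebra_axioms
  by (simp add: k_algebra_hom_def k_algebra_hom_axioms_def nonunital_algebra_iff coset_ops coset_closed)

locale k_algebra_quotient_hom =
  k_algebra_hom K A B h + dom: k_algebra_ideal K A I + cod: k_algebra_ideal K B J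
  for K (structure) and A and B and h and I and J +
  assumes image_ideal: "x \<in> I \<Longrightarrow> h x \<in> J"
begin

text \<open>This is well-definedness: by \<open>image_ideal\<close>, all representatives of a coset
  have images in a single coset of \<open>J\<close>, so \<open>the_elem\<close> is applied to a
  singleton.\<close>

lemma quotient_map_coset:
  assumes "a \<in> carrier A"
  shows "quotient_map A I B J h (dom.coset a) = cod.coset (h a)"
proof -
  have "(\<lambda>x. cod.coset (h x)) ` dom.coset a = {cod.coset (h a)}"
  proof -
    have "cod.coset (h x) = cod.coset (h a)" if "x \<in> dom.coset a" for x
      using that assms by (auto elim!: dom.cosetE simp: cod.coset_cong image_ideal)
    then show ?thesis
      using dom.coset_self[OF assms] by blast
  qed
  then show ?thesis
    using assms by (simp add: quotient_map_def dom.coset_closed)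
qed

lemma k_algebra_hom_quotient_map:
  "k_algebra_hom K (k_quotient A I) (k_quotient B J) (quotient_map A I B J h)"
  using dom.k_algebra_k_quotient cod.k_algebra_k_quotient
  by (auto simp: k_algebra_hom_def k_algebra_hom_axioms_def nonunital_algebra_iff dom.carrier_k_quotient dom.coset_ops
      cod.coset_ops quotient_map_coset cod.coset_closed dom.mult_closed hom_mult hom_smult
      dom.k_algebra_axioms cod.k_algebra_axioms)

end

lemma quotient_map_extensional: "quotient_map A I B J h \<in> extensional (carrier (k_quotient A I))"
  by (simp add: quotient_map_def)

lemma (in k_algebra_ideal) quotient_map_ident:
  assumes "\<And>x. x \<in> carrier A \<Longrightarrow> h x = x"
  shows "quotient_map A I A I h = (\<lambda>X \<in> carrier (k_quotient A I). X)"
proof -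
  interpret k_algebra_quotient_hom K A A h I I
    by unfold_locales (auto simp: assms mult_closed)
  show ?thesis
    by (rule extensionalityI[OF quotient_map_extensional])
     (auto simp: carrier_k_quotient quotient_map_coset assms)
qed

text \<open>Agreement of \<open>f\<close> with the composite is asked on the carrier only, as the
  maps concerned are extensional. The lemma is applied twice, first to pass from semigroup algebras
  to Cohn algebras and then to Leavitt algebras.\<close>

lemma quotient_map_compose:
  assumes "k_algebra_quotient_hom K A B h I J" "k_algebra_quotient_hom K B D g J L"
    and eq: "\<And>x. x \<in> carrier A \<Longrightarrow> f x = g (h x)"
  shows "quotient_map A I D L f
    = compose (carrier (k_quotient A I)) (quotient_map B J D L g) (quotient_map A I B J h)"
proof -
  interpret h: k_algebra_quotient_hom K A B h I J by fact
  interpret g: k_algebra_quotient_hom K B D g J L by fact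
  have "k_algebra_hom K A D f"
    using k_algebra_hom.k_algebra_hom_cong[OF h.k_algebra_hom_comp[OF g.k_algebra_hom_axioms]] eq
    by blast
  then interpret f: k_algebra_quotient_hom K A D f I L
    by (auto simp: k_algebra_quotient_hom_def k_algebra_quotient_hom_axioms_def eq
        h.image_ideal g.image_ideal h.dom.k_algebra_ideal_axioms g.cod.k_algebra_ideal_axioms)
  show ?thesis
    by (rule extensionalityI[OF quotient_map_extensional compose_extensional])
     (auto simp: compose_eq h.dom.carrier_k_quotient h.quotient_map_coset
        g.quotient_map_coset f.quotient_map_coset eq h.hom_closed)
qed

lemma category_k_Alg:
  fixes K :: "('k, 'm) ring_scheme"
  shows "category (k_Alg K :: (('k, 'a) module, _) category_data)"
proof
  fix X Y Z :: "('k, 'a) module" and f g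
  assume ob: "X \<in> Ob (k_Alg K)" "Y \<in> Ob (k_Alg K)" "Z \<in> Ob (k_Alg K)"
    and mor: "f \<in> Mor (k_Alg K) X Y" "g \<in> Mor (k_Alg K) Y Z"
  interpret f: k_algebra_hom K X Y f
    using ob mor by (simp add: k_Alg_def k_algebra_homs_imp_k_algebra_hom)
  interpret g: k_algebra_hom K Y Z g
    using ob mor by (simp add: k_Alg_def k_algebra_homs_imp_k_algebra_hom)
  interpret gf: k_algebra_hom K X Z "compose (carrier X) g f"
    by (rule k_algebra_hom.k_algebra_hom_cong[OF f.k_algebra_hom_comp[OF g.k_algebra_hom_axioms]])
      (simp add: compose_eq)
  show "Comp (k_Alg K) X Y Z g f \<in> Mor (k_Alg K) X Z"
    by (simp add: k_Alg_def gf.extensional_in_k_algebra_homs)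
next
  fix W X Y Z f g h
  assume "f \<in> Mor (k_Alg K) W X"
  then show "Comp (k_Alg K) W Y Z h (Comp (k_Alg K) W X Y g f)
      = Comp (k_Alg K) W X Z (Comp (k_Alg K) X Y Z h g) f"
    by (auto simp: k_Alg_def k_algebra_homs_def hom_def Pi_iff compose_def fun_eq_iff restrict_def)
next
  fix X Y f
  assume "f \<in> Mor (k_Alg K) X Y"
  then show "Comp (k_Alg K) X Y Y (Ident (k_Alg K) Y) f = f"
    "Comp (k_Alg K) X X Y f (Ident (k_Alg K) X) = f"
    by (auto simp: k_Alg_def k_algebra_homs_def hom_def Pi_iff compose_def fun_eq_iff extensional_def)
next
  fix X :: "('k, 'a) module"
  assume "X \<in> Ob (k_Alg K)"
  then interpret k_algebra K X by (simp add: k_Alg_def)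
  show "Ident (k_Alg K) X \<in> Mor (k_Alg K) X X"
    by (auto simp: k_Alg_def k_algebra_homs_def hom_def mult_closed)
qed

section \<open>Semigroup algebras\<close>

text \<open>Closure and associativity are assumed directly, since S(E) has no unit in general and so
  need not be a monoid.\<close>

locale semigroup_alg = cring K for K :: "('k, 'm) ring_scheme" (structure) +
  fixes S :: "('s, 'n) monoid_scheme"
  assumes S_closed: "\<lbrakk>s \<in> carrier S; t \<in> carrier S\<rbrakk> \<Longrightarrow> s \<otimes>\<^bsub>S\<^esub> t \<in> carrier S"
    and S_assoc: "\<lbrakk>s \<in> carrier S; t \<in> carrier S; u \<in> carrier S\<rbrakk>
          \<Longrightarrow> (s \<otimes>\<^bsub>S\<^esub> t) \<otimes>\<^bsub>S\<^esub> u = s \<otimes>\<^bsub>S\<^esub> (t \<otimes>\<^bsub>S\<^esub> u)"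
begin

abbreviation KS where "KS \<equiv> semigroup_algebra K S"
abbreviation supp where "supp \<equiv> support K S"
abbreviation bas where "bas \<equiv> basis_elem K S"

lemma carrier_iff: "f \<in> carrier KS \<longleftrightarrow> f \<in> carrier S \<rightarrow>\<^sub>E carrier K \<and> finite (supp f)"
  by (simp add: semigroup_algebra_def)

lemma finite_support: "f \<in> carrier KS \<Longrightarrow> finite (supp f)"
  by (simp add: carrier_iff)

lemma support_subset: "supp f \<subseteq> carrier S"
  by (auto simp: support_def)

lemma value_closed: "f \<in> carrier KS \<Longrightarrow> s \<in> carrier S \<Longrightarrow> f s \<in> carrier K"
  by (auto simp: carrier_iff)

lemma carrierI:
  assumes "finite A" "supp f \<subseteq> A" "f \<in> extensional (carrier S)"
    and "\<And>s. s \<in> carrier S \<Longrightarrow> f s \<in> carrier K"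
  shows "f \<in> carrier KS"
  using assms by (auto simp: carrier_iff PiE_iff intro: finite_subset)

lemma elem_eqI:
  assumes "f \<in> carrier KS" "g \<in> carrier KS" "\<And>s. s \<in> carrier S \<Longrightarrow> f s = g s"
  shows "f = g"
  using assms by (auto simp: carrier_iff PiE_iff intro: extensionalityI)

lemma zero_apply: "s \<in> carrier S \<Longrightarrow> \<zero>\<^bsub>KS\<^esub> s = \<zero>"
  and add_apply: "s \<in> carrier S \<Longrightarrow> (f \<oplus>\<^bsub>KS\<^esub> g) s = f s \<oplus> g s"
  and smult_apply: "s \<in> carrier S \<Longrightarrow> (c \<odot>\<^bsub>KS\<^esub> f) s = c \<otimes> f s"
  and basis_apply: "s \<in> carrier S \<Longrightarrow> bas t s = (if s = t then \<one> else \<zero>)"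
  by (simp_all add: semigroup_algebra_def basis_elem_def)

lemmas apply_simps = zero_apply add_apply smult_apply basis_apply

lemma ops_extensional:
  "\<zero>\<^bsub>KS\<^esub> \<in> extensional (carrier S)" "f \<oplus>\<^bsub>KS\<^esub> g \<in> extensional (carrier S)"
  "c \<odot>\<^bsub>KS\<^esub> f \<in> extensional (carrier S)" "f \<otimes>\<^bsub>KS\<^esub> g \<in> extensional (carrier S)"
  "bas t \<in> extensional (carrier S)"
  by (simp_all add: semigroup_algebra_def basis_elem_def)

lemma zero_in: "\<zero>\<^bsub>KS\<^esub> \<in> carrier KS"
  by (rule carrierI[of "{}"]) (auto simp: support_def apply_simps ops_extensional)

lemma add_in: "f \<in> carrier KS \<Longrightarrow> g \<in> carrier KS \<Longrightarrow> f \<oplus>\<^bsub>KS\<^esub> g \<in> carrier KS"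
  by (rule carrierI[of "supp f \<union> supp g"])
    (auto simp: support_def apply_simps ops_extensional value_closed finite_support[unfolded support_def])

lemma smult_in: "c \<in> carrier K \<Longrightarrow> f \<in> carrier KS \<Longrightarrow> c \<odot>\<^bsub>KS\<^esub> f \<in> carrier KS"
  by (rule carrierI[of "supp f"])
    (auto simp: support_def apply_simps ops_extensional value_closed finite_support[unfolded support_def])

lemma basis_in: "bas s \<in> carrier KS"
  by (rule carrierI[of "{s}"]) (auto simp: support_def apply_simps ops_extensional split: if_splits)

lemmas ops_in = zero_in add_in smult_in basis_in

lemma abelian_group_KS: "abelian_group KS"
proof (rule abelian_groupI)
  fix f assume f: "f \<in> carrier KS"
  then show "\<exists>g\<in>carrier KS. g \<oplus>\<^bsub>KS\<^esub> f = \<zero>\<^bsub>KS\<^esub>"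
    by (intro bexI[of _ "(\<ominus> \<one>) \<odot>\<^bsub>KS\<^esub> f"])
      (auto intro!: elem_eqI simp: ops_in apply_simps value_closed l_minus l_neg)
  show "\<zero>\<^bsub>KS\<^esub> \<oplus>\<^bsub>KS\<^esub> f = f"
    using f by (auto intro!: elem_eqI simp: ops_in apply_simps value_closed)
qed (auto intro!: elem_eqI simp: ops_in apply_simps value_closed a_ac)

lemma module_KS: "Module.module K KS"
  by (rule moduleI[OF is_cring abelian_group_KS])
    (auto intro!: elem_eqI simp: ops_in apply_simps value_closed l_distr r_distr m_assoc)

text \<open>The index set becomes a rectangle that may be larger than the product of the supports,
  with the condition on the product moved into the summand. Products of elements with different
  supports can then be compared as sums over one index set.\<close>

lemma mult_apply:
  assumes f: "f \<in> carrier KS" and g: "g \<in> carrier KS" and t: "t \<in> carrier S"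
    and A: "finite A" "supp f \<subseteq> A" "A \<subseteq> carrier S"
    and B: "finite B" "supp g \<subseteq> B" "B \<subseteq> carrier S"
  shows "(f \<otimes>\<^bsub>KS\<^esub> g) t
    = (\<Oplus>p\<in>A \<times> B. if fst p \<otimes>\<^bsub>S\<^esub> snd p = t then f (fst p) \<otimes> g (snd p) else \<zero>)"
proof -
  have "(f \<otimes>\<^bsub>KS\<^esub> g) t
    = (\<Oplus>p\<in>{p \<in> supp f \<times> supp g. fst p \<otimes>\<^bsub>S\<^esub> snd p = t}. f (fst p) \<otimes> g (snd p))"
    using t by (simp add: semigroup_algebra_def)
  also have "\<dots> = (\<Oplus>p\<in>A \<times> B. if fst p \<otimes>\<^bsub>S\<^esub> snd p = t then f (fst p) \<otimes> g (snd p) else \<zero>)"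
  proof (rule add.finprod_mono_neutral_cong_left)
    fix p
    assume p: "p \<in> A \<times> B - {p \<in> supp f \<times> supp g. fst p \<otimes>\<^bsub>S\<^esub> snd p = t}"
    then have "fst p \<in> carrier S" "snd p \<in> carrier S"
      using A B by auto
    with p show "(if fst p \<otimes>\<^bsub>S\<^esub> snd p = t then f (fst p) \<otimes> g (snd p) else \<zero>) = \<zero>"
      using f g by (auto simp: support_def value_closed)
  qed (use A B f g value_closed in \<open>auto simp: subset_iff\<close>)
  finally show ?thesis .
qed

lemma mult_apply_subset:
  assumes "f \<in> carrier KS" "g \<in> carrier KS" "t \<in> carrier S"
  shows "(f \<otimes>\<^bsub>KS\<^esub> g) t = (\<Oplus>p\<in>supp f \<times> supp g.
    if fst p \<otimes>\<^bsub>S\<^esub> snd p = t then f (fst p) \<otimes> g (snd p) else \<zero>)"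
  by (rule mult_apply[OF assms]) (simp_all add: assms finite_support support_subset)

lemma mult_in:
  assumes f: "f \<in> carrier KS" and g: "g \<in> carrier KS"
  shows "f \<otimes>\<^bsub>KS\<^esub> g \<in> carrier KS"
proof (rule carrierI)
  let ?A = "(\<lambda>p. fst p \<otimes>\<^bsub>S\<^esub> snd p) ` (supp f \<times> supp g)"
  show "finite ?A"
    using f g by (simp add: finite_support)
  show "(f \<otimes>\<^bsub>KS\<^esub> g) t \<in> carrier K" if "t \<in> carrier S" for t
    using f g that support_subset
    by (auto simp: mult_apply_subset value_closed subset_iff intro!: add.finprod_closed)
  show "supp (f \<otimes>\<^bsub>KS\<^esub> g) \<subseteq> ?A"
  proof
    fix t assume t: "t \<in> supp (f \<otimes>\<^bsub>KS\<^esub> g)"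
    show "t \<in> ?A"
    proof (rule ccontr)
      assume "t \<notin> ?A"
      then have "(\<Oplus>p\<in>supp f \<times> supp g.
          if fst p \<otimes>\<^bsub>S\<^esub> snd p = t then f (fst p) \<otimes> g (snd p) else \<zero>) = \<zero>"
        by (intro add.finprod_one_eqI) auto
      then show False
        using t f g mult_apply_subset[of f g t] by (simp add: support_def)
    qed
  qed
qed (rule ops_extensional)

lemma mult_basis:
  assumes "s \<in> carrier S" "t \<in> carrier S"
  shows "bas s \<otimes>\<^bsub>KS\<^esub> bas t = bas (s \<otimes>\<^bsub>S\<^esub> t)"
proof (rule elem_eqI)
  fix u assume u: "u \<in> carrier S"
  have "supp (bas s) \<subseteq> {s}" "supp (bas t) \<subseteq> {t}"
    by (auto simp: support_def basis_apply split: if_splits)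
  then show "(bas s \<otimes>\<^bsub>KS\<^esub> bas t) u = bas (s \<otimes>\<^bsub>S\<^esub> t) u"
    using assms u by (auto simp: mult_apply[of _ _ _ "{s}" "{t}"] basis_in basis_apply)
qed (auto simp: basis_in mult_in)

text \<open>Reduces statements that are linear in \<open>f\<close> to basis elements, by induction
  on a finite set containing the support.\<close>

lemma KS_induct [consumes 1, case_names zero basis add smult]:
  assumes "f \<in> carrier KS"
    and zero: "P \<zero>\<^bsub>KS\<^esub>"
    and basis: "\<And>s. s \<in> carrier S \<Longrightarrow> P (bas s)"
    and add: "\<And>f g. \<lbrakk>f \<in> carrier KS; g \<in> carrier KS; P f; P g\<rbrakk> \<Longrightarrow> P (f \<oplus>\<^bsub>KS\<^esub> g)"
    and smult: "\<And>c f. \<lbrakk>c \<in> carrier K; f \<in> carrier KS; P f\<rbrakk> \<Longrightarrow> P (c \<odot>\<^bsub>KS\<^esub> f)"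
  shows "P f"
proof -
  have "P f" if "finite A" "A \<subseteq> carrier S" "f \<in> carrier KS" "supp f \<subseteq> A" for A f
    using that
  proof (induction A arbitrary: f rule: finite_induct)
    case empty
    have "f = \<zero>\<^bsub>KS\<^esub>"
      using empty by (intro elem_eqI) (auto simp: ops_in zero_apply support_def)
    with zero show ?case
      by simp
  next
    case (insert s A)
    \<comment> \<open>Erasing the value at \<open>s\<close> leaves an element supported in the
      smaller set; what was erased is the multiple \<open>f s\<close> of the basis element of
      \<open>s\<close>.\<close>
    let ?g = "f(s := \<zero>)"
    have s: "s \<in> carrier S"
      using insert by simp
    have g: "?g \<in> carrier KS"
      using insert.prems s insert.hyps
      by (intro carrierI[of A]) (auto simp: support_def value_closed carrier_iff PiE_iff extensional_def)
    have "P ?g"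
      using insert.prems by (intro insert.IH[OF _ g]) (auto simp: support_def)
    moreover have "f = ?g \<oplus>\<^bsub>KS\<^esub> f s \<odot>\<^bsub>KS\<^esub> bas s"
      using insert.prems g s by (intro elem_eqI) (auto simp: ops_in apply_simps value_closed)
    moreover have "f s \<in> carrier K"
      using s insert.prems value_closed by simp
    ultimately show ?case
      using add[OF g smult_in] smult basis_in basis[OF s] by metis
  qed
  then show ?thesis
    using assms(1) finite_support[of f] by (auto simp: support_def)
qed

section \<open>Bilinearity and associativity of the convolution product\<close>

lemma mult_KS_add_left:
  assumes f: "f \<in> carrier KS" and g: "g \<in> carrier KS" and h: "h \<in> carrier KS"
  shows "(f \<oplus>\<^bsub>KS\<^esub> g) \<otimes>\<^bsub>KS\<^esub> h = f \<otimes>\<^bsub>KS\<^esub> h \<oplus>\<^bsub>KS\<^esub> g \<otimes>\<^bsub>KS\<^esub> h"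
proof (rule elem_eqI)
  fix t assume t: "t \<in> carrier S"
  let ?A = "supp f \<union> supp g" and ?B = "supp h"
  have A: "finite ?A" "?A \<subseteq> carrier S" "supp (f \<oplus>\<^bsub>KS\<^esub> g) \<subseteq> ?A"
    and B: "finite ?B" "?B \<subseteq> carrier S"
    using f g h support_subset
    by (auto simp: finite_support) (auto simp: support_def add_apply)
  have closed: "fst p \<in> carrier S" "snd p \<in> carrier S" if "p \<in> ?A \<times> ?B" for p
    using that A B by auto
  show "((f \<oplus>\<^bsub>KS\<^esub> g) \<otimes>\<^bsub>KS\<^esub> h) t = (f \<otimes>\<^bsub>KS\<^esub> h \<oplus>\<^bsub>KS\<^esub> g \<otimes>\<^bsub>KS\<^esub> h) t"
    using A B f g h t closed
    by (auto simp: mult_apply[of _ _ _ ?A ?B] ops_in mult_in add_apply value_closed l_distr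
        simp flip: finsum_addf intro!: finsum_cong')
qed (use assms in \<open>simp_all add: ops_in mult_in\<close>)

lemma mult_KS_add_right:
  assumes f: "f \<in> carrier KS" and g: "g \<in> carrier KS" and h: "h \<in> carrier KS"
  shows "h \<otimes>\<^bsub>KS\<^esub> (f \<oplus>\<^bsub>KS\<^esub> g) = h \<otimes>\<^bsub>KS\<^esub> f \<oplus>\<^bsub>KS\<^esub> h \<otimes>\<^bsub>KS\<^esub> g"
proof (rule elem_eqI)
  fix t assume t: "t \<in> carrier S"
  let ?A = "supp h" and ?B = "supp f \<union> supp g"
  have A: "finite ?A" "?A \<subseteq> carrier S"
    and B: "finite ?B" "?B \<subseteq> carrier S" "supp (f \<oplus>\<^bsub>KS\<^esub> g) \<subseteq> ?B"
    using f g h support_subset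
    by (auto simp: finite_support) (auto simp: support_def add_apply)
  have closed: "fst p \<in> carrier S" "snd p \<in> carrier S" if "p \<in> ?A \<times> ?B" for p
    using that A B by auto
  show "(h \<otimes>\<^bsub>KS\<^esub> (f \<oplus>\<^bsub>KS\<^esub> g)) t = (h \<otimes>\<^bsub>KS\<^esub> f \<oplus>\<^bsub>KS\<^esub> h \<otimes>\<^bsub>KS\<^esub> g) t"
    using A B f g h t closed
    by (auto simp: mult_apply[of _ _ _ ?A ?B] ops_in mult_in add_apply value_closed r_distr
        simp flip: finsum_addf intro!: finsum_cong')
qed (use assms in \<open>simp_all add: ops_in mult_in\<close>)

lemma mult_KS_smult_left:
  assumes c: "c \<in> carrier K" and f: "f \<in> carrier KS" and g: "g \<in> carrier KS"
  shows "(c \<odot>\<^bsub>KS\<^esub> f) \<otimes>\<^bsub>KS\<^esub> g = c \<odot>\<^bsub>KS\<^esub> (f \<otimes>\<^bsub>KS\<^esub> g)"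
proof (rule elem_eqI)
  fix t assume t: "t \<in> carrier S"
  have sub: "supp (c \<odot>\<^bsub>KS\<^esub> f) \<subseteq> supp f"
    using c by (auto simp: support_def smult_apply)
  have closed: "fst p \<in> carrier S" "snd p \<in> carrier S" if "p \<in> supp f \<times> supp g" for p
    using that by (auto simp: support_def)
  show "((c \<odot>\<^bsub>KS\<^esub> f) \<otimes>\<^bsub>KS\<^esub> g) t = (c \<odot>\<^bsub>KS\<^esub> (f \<otimes>\<^bsub>KS\<^esub> g)) t"
    using f g t c closed sub
    by (auto simp: mult_apply[of _ _ _ "supp f" "supp g"] finite_support support_subset ops_in
        smult_apply value_closed finsum_rdistr m_assoc intro!: finsum_cong')
qed (use assms in \<open>simp_all add: ops_in mult_in\<close>)

lemma mult_KS_smult_right: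
  assumes c: "c \<in> carrier K" and f: "f \<in> carrier KS" and g: "g \<in> carrier KS"
  shows "f \<otimes>\<^bsub>KS\<^esub> (c \<odot>\<^bsub>KS\<^esub> g) = c \<odot>\<^bsub>KS\<^esub> (f \<otimes>\<^bsub>KS\<^esub> g)"
proof (rule elem_eqI)
  fix t assume t: "t \<in> carrier S"
  have sub: "supp (c \<odot>\<^bsub>KS\<^esub> g) \<subseteq> supp g"
    using c by (auto simp: support_def smult_apply)
  have closed: "fst p \<in> carrier S" "snd p \<in> carrier S" if "p \<in> supp f \<times> supp g" for p
    using that by (auto simp: support_def)
  show "(f \<otimes>\<^bsub>KS\<^esub> (c \<odot>\<^bsub>KS\<^esub> g)) t = (c \<odot>\<^bsub>KS\<^esub> (f \<otimes>\<^bsub>KS\<^esub> g)) t"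
    using f g t c closed sub
    by (auto simp: mult_apply[of _ _ _ "supp f" "supp g"] finite_support support_subset ops_in
        smult_apply value_closed finsum_rdistr m_lcomm intro!: finsum_cong')
qed (use assms in \<open>simp_all add: ops_in mult_in\<close>)

lemma mult_KS_zero:
  assumes "f \<in> carrier KS"
  shows "\<zero>\<^bsub>KS\<^esub> \<otimes>\<^bsub>KS\<^esub> f = \<zero>\<^bsub>KS\<^esub>" "f \<otimes>\<^bsub>KS\<^esub> \<zero>\<^bsub>KS\<^esub> = \<zero>\<^bsub>KS\<^esub>"
proof -
  have "supp \<zero>\<^bsub>KS\<^esub> \<subseteq> {}"
    by (auto simp: support_def zero_apply)
  then show "\<zero>\<^bsub>KS\<^esub> \<otimes>\<^bsub>KS\<^esub> f = \<zero>\<^bsub>KS\<^esub>" "f \<otimes>\<^bsub>KS\<^esub> \<zero>\<^bsub>KS\<^esub> = \<zero>\<^bsub>KS\<^esub>"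
    using assms
    by (auto intro!: elem_eqI simp: mult_in zero_in zero_apply mult_apply_subset)
qed

lemmas mult_KS_bilinear =
  mult_KS_add_left mult_KS_add_right mult_KS_smult_left mult_KS_smult_right mult_KS_zero

text \<open>Both sides are linear in each factor, so three nested inductions leave only basis
  elements, where the claim is associativity in \<open>S\<close>.\<close>

lemma mult_KS_assoc:
  assumes "f \<in> carrier KS" "g \<in> carrier KS" "h \<in> carrier KS"
  shows "(f \<otimes>\<^bsub>KS\<^esub> g) \<otimes>\<^bsub>KS\<^esub> h = f \<otimes>\<^bsub>KS\<^esub> (g \<otimes>\<^bsub>KS\<^esub> h)"
  using assms
proof (induction f rule: KS_induct)
  case (basis r)
  from basis(2,3,1) show ?case
  proof (induction g rule: KS_induct)
    case (basis s)
    from basis(2,1,3) show ?case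
      by (induction h rule: KS_induct)
        (simp_all add: mult_KS_bilinear mult_in ops_in mult_basis S_closed S_assoc)
  qed (simp_all add: mult_KS_bilinear mult_in ops_in)
qed (simp_all add: mult_KS_bilinear mult_in ops_in)

lemma k_algebra_KS: "k_algebra K KS"
  using module_KS
  by (simp add: k_algebra_def k_algebra_axioms_def mult_in mult_KS_assoc mult_KS_bilinear)

lemma k_algebra_hom_KS_eqI:
  assumes "k_algebra_hom K KS A g" "k_algebra_hom K KS A h"
    and "\<And>s. s \<in> carrier S \<Longrightarrow> g (bas s) = h (bas s)" and "f \<in> carrier KS"
  shows "g f = h f"
proof -
  interpret g: k_algebra_hom K KS A g by fact
  interpret h: k_algebra_hom K KS A h by fact
  show ?thesis
    using assms(4,3)
    by (induction f rule: KS_induct) (simp_all add: g.hom_smult h.hom_smult)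
qed

end

section \<open>The linear extension of a semigroup homomorphism\<close>

locale semigroup_alg_hom = S: semigroup_alg K S + T: semigroup_alg K T
  for K :: "('k, 'm) ring_scheme" (structure) and S :: "('s, 'n) monoid_scheme"
    and T :: "('t, 'l) monoid_scheme" +
  fixes \<phi>
  assumes \<phi>_hom: "\<phi> \<in> hom S T"
begin

abbreviation KS_map where "KS_map \<equiv> semigroup_algebra_map K S T \<phi>"

lemma \<phi>_closed: "s \<in> carrier S \<Longrightarrow> \<phi> s \<in> carrier T"
  and \<phi>_mult: "s \<in> carrier S \<Longrightarrow> t \<in> carrier S \<Longrightarrow> \<phi> (s \<otimes>\<^bsub>S\<^esub> t) = \<phi> s \<otimes>\<^bsub>T\<^esub> \<phi> t"
  using \<phi>_hom by (auto simp: hom_def)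

lemma KS_map_apply:
  assumes f: "f \<in> carrier S.KS" and t: "t \<in> carrier T"
    and A: "finite A" "S.supp f \<subseteq> A" "A \<subseteq> carrier S"
  shows "KS_map f t = (\<Oplus>s\<in>A. if \<phi> s = t then f s else \<zero>)"
proof -
  have "KS_map f t = (\<Oplus>s\<in>{s \<in> S.supp f. \<phi> s = t}. f s)"
    using f t by (simp add: semigroup_algebra_map_def)
  also have "\<dots> = (\<Oplus>s\<in>A. if \<phi> s = t then f s else \<zero>)"
  proof (rule S.add.finprod_mono_neutral_cong_left)
    fix s
    assume "s \<in> A - {s \<in> S.supp f. \<phi> s = t}"
    then show "(if \<phi> s = t then f s else \<zero>) = \<zero>"
      using A by (auto simp: support_def)
  qed (use A f S.value_closed in \<open>auto simp: subset_iff\<close>)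
  finally show ?thesis .
qed

lemma KS_map_in:
  assumes f: "f \<in> carrier S.KS"
  shows "KS_map f \<in> carrier T.KS"
proof (rule T.carrierI)
  let ?A = "\<phi> ` S.supp f"
  show "finite ?A"
    using f by (simp add: S.finite_support)
  show "KS_map f t \<in> carrier K" if "t \<in> carrier T" for t
    using f that S.support_subset
    by (auto simp: KS_map_apply[of _ _ "S.supp f"] S.finite_support S.value_closed subset_iff
        intro!: S.add.finprod_closed)
  show "T.supp (KS_map f) \<subseteq> ?A"
  proof
    fix t assume t: "t \<in> T.supp (KS_map f)"
    show "t \<in> ?A"
    proof (rule ccontr)
      assume "t \<notin> ?A"
      then have "(\<Oplus>s\<in>S.supp f. if \<phi> s = t then f s else \<zero>) = \<zero>"
        by (intro S.add.finprod_one_eqI) auto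
      then show False
        using t f KS_map_apply[of f t "S.supp f"] S.support_subset S.finite_support
        by (simp add: support_def)
    qed
  qed
  show "KS_map f \<in> extensional (carrier T)"
    using f by (simp add: semigroup_algebra_map_def)
qed

lemma KS_map_basis:
  assumes "s \<in> carrier S"
  shows "KS_map (S.bas s) = T.bas (\<phi> s)"
proof (rule T.elem_eqI)
  fix t assume "t \<in> carrier T"
  moreover have "S.supp (S.bas s) \<subseteq> {s}"
    by (auto simp: support_def S.basis_apply split: if_splits)
  ultimately show "KS_map (S.bas s) t = T.bas (\<phi> s) t"
    using assms by (auto simp: KS_map_apply[of _ _ "{s}"] S.basis_in S.basis_apply T.basis_apply)
qed (simp_all add: KS_map_in S.basis_in T.basis_in)

lemma KS_map_add:
  assumes f: "f \<in> carrier S.KS" and g: "g \<in> carrier S.KS"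
  shows "KS_map (f \<oplus>\<^bsub>S.KS\<^esub> g) = KS_map f \<oplus>\<^bsub>T.KS\<^esub> KS_map g"
proof (rule T.elem_eqI)
  fix t assume t: "t \<in> carrier T"
  let ?A = "S.supp f \<union> S.supp g"
  have A: "finite ?A" "?A \<subseteq> carrier S" "S.supp (f \<oplus>\<^bsub>S.KS\<^esub> g) \<subseteq> ?A"
    using f g S.support_subset
    by (auto simp: S.finite_support) (auto simp: support_def S.add_apply)
  have closed: "s \<in> carrier S" if "s \<in> ?A" for s
    using that A by auto
  show "KS_map (f \<oplus>\<^bsub>S.KS\<^esub> g) t = (KS_map f \<oplus>\<^bsub>T.KS\<^esub> KS_map g) t"
    using A f g t closed
    by (auto simp: KS_map_apply[of _ _ ?A] S.ops_in S.add_apply T.add_apply S.value_closed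
        simp flip: S.finsum_addf intro!: S.finsum_cong')
qed (use assms in \<open>simp_all add: S.ops_in T.ops_in KS_map_in\<close>)

lemma KS_map_smult:
  assumes c: "c \<in> carrier K" and f: "f \<in> carrier S.KS"
  shows "KS_map (c \<odot>\<^bsub>S.KS\<^esub> f) = c \<odot>\<^bsub>T.KS\<^esub> KS_map f"
proof (rule T.elem_eqI)
  fix t assume t: "t \<in> carrier T"
  have sub: "S.supp (c \<odot>\<^bsub>S.KS\<^esub> f) \<subseteq> S.supp f"
    using c by (auto simp: support_def S.smult_apply)
  have closed: "s \<in> carrier S" if "s \<in> S.supp f" for s
    using that S.support_subset by auto
  show "KS_map (c \<odot>\<^bsub>S.KS\<^esub> f) t = (c \<odot>\<^bsub>T.KS\<^esub> KS_map f) t"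
    using f t c closed sub
    by (auto simp: KS_map_apply[of _ _ "S.supp f"] S.finite_support S.support_subset S.ops_in
        S.smult_apply T.smult_apply S.value_closed S.finsum_rdistr intro!: S.finsum_cong')
qed (use assms in \<open>simp_all add: S.ops_in T.ops_in KS_map_in\<close>)

lemma KS_map_zero: "KS_map \<zero>\<^bsub>S.KS\<^esub> = \<zero>\<^bsub>T.KS\<^esub>"
proof (rule T.elem_eqI)
  show "KS_map \<zero>\<^bsub>S.KS\<^esub> t = \<zero>\<^bsub>T.KS\<^esub> t" if "t \<in> carrier T" for t
    using that S.zero_apply
    by (auto simp: KS_map_apply[of _ _ "{}"] S.zero_in T.zero_apply support_def)
qed (simp_all add: S.zero_in T.zero_in KS_map_in)

lemma KS_map_mult:
  assumes "f \<in> carrier S.KS" "g \<in> carrier S.KS"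
  shows "KS_map (f \<otimes>\<^bsub>S.KS\<^esub> g) = KS_map f \<otimes>\<^bsub>T.KS\<^esub> KS_map g"
  using assms
proof (induction f rule: S.KS_induct)
  case (basis s)
  from basis(2,1) show ?case
    by (induction g rule: S.KS_induct)
      (simp_all add: S.mult_KS_bilinear T.mult_KS_bilinear S.mult_in S.ops_in KS_map_in KS_map_add
        KS_map_smult KS_map_zero KS_map_basis S.mult_basis T.mult_basis T.basis_in S.S_closed
        \<phi>_closed \<phi>_mult)
qed (simp_all add: S.mult_KS_bilinear T.mult_KS_bilinear S.mult_in S.ops_in KS_map_in KS_map_add
      KS_map_smult KS_map_zero)

lemma k_algebra_hom_KS_map: "k_algebra_hom K S.KS T.KS KS_map"
  by (simp add: k_algebra_hom_def k_algebra_hom_axioms_def nonunital_algebra_iff S.k_algebra_KS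
      T.k_algebra_KS KS_map_in KS_map_mult KS_map_add KS_map_smult)

end

section \<open>Paths and the graph inverse semigroup\<close>

lemma path_append_Nil [simp]: "path_append \<alpha> [] = \<alpha>"
  and path_append_append [simp]: "path_append (path_append \<alpha> p) q = path_append \<alpha> (p @ q)"
  and path_append_inject [simp]: "path_append \<alpha> p = path_append \<alpha> q \<longleftrightarrow> p = q"
  and path_append_eq_self [simp]: "path_append \<alpha> p = \<alpha> \<longleftrightarrow> p = []"
  and path_rest_append [simp]: "path_rest \<alpha> (path_append \<alpha> p) = p"
  and path_rest_self [simp]: "path_rest \<alpha> \<alpha> = []"
  by (auto simp: path_append_def path_rest_def prod_eq_iff)

lemma path_prefix_iff: "path_prefix \<alpha> \<beta> \<longleftrightarrow> (\<exists>p. \<beta> = path_append \<alpha> p)"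
  by (auto simp: path_prefix_def path_append_def prefix_def prod_eq_iff)

lemma path_append_rest: "path_prefix \<alpha> \<beta> \<Longrightarrow> path_append \<alpha> (path_rest \<alpha> \<beta>) = \<beta>"
  by (auto simp: path_prefix_iff)

lemma path_prefix_append_cancel [simp]:
  "path_prefix (path_append \<alpha> p) (path_append \<alpha> q) \<longleftrightarrow> prefix p q"
  by (simp add: path_prefix_def path_append_def)

lemma path_prefix_append_self [simp]: "path_prefix \<alpha> (path_append \<alpha> p)"
  by (auto simp: path_prefix_iff)

lemma path_prefix_refl [simp]: "path_prefix \<alpha> \<alpha>"
  by (simp add: path_prefix_def)

lemma path_prefix_trans: "path_prefix \<alpha> \<beta> \<Longrightarrow> path_prefix \<beta> \<gamma> \<Longrightarrow> path_prefix \<alpha> \<gamma>"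
  by (auto simp: path_prefix_def)

lemma path_prefix_antisym: "path_prefix \<alpha> \<beta> \<Longrightarrow> path_prefix \<beta> \<alpha> \<Longrightarrow> \<alpha> = \<beta>"
  by (auto simp: path_prefix_def prod_eq_iff)

lemma path_prefix_same_cases:
  "path_prefix \<alpha> \<gamma> \<Longrightarrow> path_prefix \<beta> \<gamma> \<Longrightarrow> path_prefix \<alpha> \<beta> \<or> path_prefix \<beta> \<alpha>"
  unfolding path_prefix_def by (metis prefix_same_cases)

lemma gis_mult_GZero_right [simp]: "gis_mult s GZero = GZero"
  by (cases s) auto

text \<open>
  The element \<open>(\<alpha>, \<beta>)\<close> acts on paths as the partial injection \<open>\<beta>x \<mapsto> \<alpha>x\<close>. This action is
  faithful, which reduces associativity to that of the composition of partial maps.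
\<close>

fun gis_act :: "('v, 'e) gis \<Rightarrow> ('v, 'e) fpath \<Rightarrow> ('v, 'e) fpath option" where
  "gis_act GZero = Map.empty"
| "gis_act (GPair \<alpha> \<beta>) =
    (\<lambda>x. if path_prefix \<beta> x then Some (path_append \<alpha> (path_rest \<beta> x)) else None)"

lemma gis_act_mult: "gis_act (gis_mult s t) = gis_act s \<circ>\<^sub>m gis_act t"
proof (cases s; cases t)
  fix \<alpha> \<beta> \<gamma> \<delta> :: "('a, 'b) fpath"
  assume st: "s = GPair \<alpha> \<beta>" "t = GPair \<gamma> \<delta>"
  have "gis_act (gis_mult s t) x = (gis_act s \<circ>\<^sub>m gis_act t) x" for x
  proof (cases "path_prefix \<beta> \<gamma>")
    case True
    then obtain r where "\<gamma> = path_append \<beta> r"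
      by (auto simp: path_prefix_iff)
    then show ?thesis
      using st by (auto simp: map_comp_def path_prefix_iff)
  next
    case False
    show ?thesis
    proof (cases "path_prefix \<gamma> \<beta>")
      \<comment> \<open>The product is now (\<alpha>, \<delta>r), so both partial maps are defined
        exactly at the extensions of \<delta>r.\<close>
      case True
      then obtain r where r: "\<beta> = path_append \<gamma> r"
        by (auto simp: path_prefix_iff)
      show ?thesis
      proof (cases "path_prefix \<delta> x")
        case True
        then obtain w where "x = path_append \<delta> w"
          by (auto simp: path_prefix_iff)
        then show ?thesis
          using st False r by (auto simp: map_comp_def path_rest_def path_append_def path_prefix_def)
      next
        case not: False
        then have "\<not> path_prefix (path_append \<delta> r) x"
          using path_prefix_trans path_prefix_append_self by blast
        then show ?thesis
          using st False r not by (simp add: map_comp_def)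
      qed
    next
      case not: False
      \<comment> \<open>Two prefixes of one path are comparable. As \<beta> and \<gamma> are not, no
        value \<gamma>w of the second map lies in the domain of the first, and the composite is
        empty like the action of 0.\<close>
      then have "\<not> path_prefix \<beta> (path_append \<gamma> w)" for w
        using False path_prefix_same_cases path_prefix_append_self by blast
      then show ?thesis
        using st False not by (auto simp: map_comp_def)
    qed
  qed
  then show ?thesis
    by blast
qed (auto simp: map_comp_def)

text \<open>The domain of the map of (\<alpha>, \<beta>) has \<beta> as its least element in the
  prefix order, and the value there is \<alpha>; so the map determines the pair. Being nowhere
  defined singles out 0.\<close>

lemma inj_gis_act: "inj gis_act"
proof (rule injI)
  fix s t :: "('v, 'e) gis"
  assume eq: "gis_act s = gis_act t"
  have act_self: "gis_act (GPair \<alpha> \<beta>) \<beta> = Some \<alpha>" for \<alpha> \<beta> :: "('v, 'e) fpath"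
    by simp
  show "s = t"
  proof (cases s; cases t)
    fix \<alpha> \<beta> \<gamma> \<delta> :: "('v, 'e) fpath"
    assume st: "s = GPair \<alpha> \<beta>" "t = GPair \<gamma> \<delta>"
    have "gis_act t \<beta> = Some \<alpha>" "gis_act s \<delta> = Some \<gamma>"
      using act_self st eq by metis+
    then have "path_prefix \<delta> \<beta>" "path_prefix \<beta> \<delta>"
      using st by (auto split: if_splits)
    then have "\<beta> = \<delta>"
      by (rule path_prefix_antisym[rotated])
    with \<open>gis_act t \<beta> = Some \<alpha>\<close> act_self st show ?thesis
      by (metis option.inject)
  qed (use eq act_self in \<open>metis gis_act.simps(1) option.distinct(1)\<close>)+
qed

text \<open>The prefix order makes sense for arbitrary edge lists, so the identity holds on the
  whole type and not only on the carrier of one S(E).\<close>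

lemma gis_mult_assoc: "gis_mult (gis_mult s t) u = gis_mult s (gis_mult t u)"
  by (rule injD[OF inj_gis_act])
    (auto simp: gis_act_mult map_comp_def fun_eq_iff split: option.splits)

lemma idem_inject [simp]: "idem \<alpha> = idem \<beta> \<longleftrightarrow> \<alpha> = \<beta>"
  and idem_neq_GZero [simp]: "idem \<alpha> \<noteq> GZero" "GZero \<noteq> idem \<alpha>"
  by (simp_all add: idem_def)

lemma idem_mult_idem:
  "gis_mult (idem \<alpha>) (idem \<beta>)
    = (if path_prefix \<alpha> \<beta> then idem \<beta> else if path_prefix \<beta> \<alpha> then idem \<alpha> else GZero)"
  by (simp add: idem_def path_append_rest)

text \<open>If \<alpha> = \<beta>p, the square of (\<alpha>, \<beta>) is (\<alpha>p, \<beta>), which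
  forces p to be empty; the case \<beta> = \<alpha>p is symmetric, and for incomparable paths the
  square is 0.\<close>

lemma idempotent_cases:
  assumes "gis_mult s s = s"
  obtains "s = GZero" | \<alpha> where "s = idem \<alpha>"
proof (cases s)
  case (GPair \<alpha> \<beta>)
  have "\<alpha> = \<beta>"
  proof (cases "path_prefix \<beta> \<alpha>")
    case True
    then obtain p where "\<alpha> = path_append \<beta> p"
      by (auto simp: path_prefix_iff)
    then show ?thesis
      using assms GPair by simp
  next
    case False
    then obtain p where "\<beta> = path_append \<alpha> p"
      using assms GPair by (auto simp: path_prefix_iff split: if_splits)
    then show ?thesis
      using assms GPair False by simp
  qed
  then show ?thesis
    using that GPair by (simp add: idem_def)
qed (use that in simp)

lemma idempotent_mult_commute:
  assumes "gis_mult s s = s" "gis_mult t t = t"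
  shows "gis_mult s t = gis_mult t s"
proof -
  have "gis_mult (idem \<alpha>) (idem \<beta>) = gis_mult (idem \<beta>) (idem \<alpha>)" for \<alpha> \<beta> :: "('a, 'b) fpath"
    by (auto simp: idem_mult_idem dest: path_prefix_antisym)
  then show ?thesis
    using assms by (elim idempotent_cases) auto
qed

text \<open>For t = (\<alpha>, \<delta>) the product of t with \<open>gis_star t\<close> is
  (\<alpha>, \<alpha>). Hence t \<le> s writes t as a product of two idempotents, which is again an
  idempotent.\<close>

lemma gis_le_idempotent_iff:
  assumes "gis_mult s s = s"
  shows "gis_le t s \<longleftrightarrow> gis_mult t t = t \<and> gis_mult t s = t"
proof
  assume le: "gis_le t s"
  show "gis_mult t t = t \<and> gis_mult t s = t"
  proof (cases t)
    case (GPair \<alpha> \<delta>)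
    with le have eq: "gis_mult (idem \<alpha>) s = GPair \<alpha> \<delta>"
      by (simp add: gis_le_def idem_def path_prefix_iff)
    obtain \<beta> where s: "s = idem \<beta>"
      using assms eq by (auto elim: idempotent_cases)
    have "\<alpha> = \<delta>"
      using eq unfolding s idem_mult_idem by (auto simp: idem_def split: if_splits)
    then show ?thesis
      using GPair eq idem_mult_idem[of \<alpha> \<alpha>] by (simp add: idem_def)
  qed simp
next
  assume t: "gis_mult t t = t \<and> gis_mult t s = t"
  then have "gis_star t = t"
    by (auto elim!: idempotent_cases simp: idem_def)
  with t show "gis_le t s"
    by (simp add: gis_le_def)
qed

section \<open>Paths of a graph and closure of S(E) under multiplication\<close>

context wf_digraph
begin

lemma FP_iff: "\<alpha> \<in> FP G \<longleftrightarrow> awalk (fst \<alpha>) (snd \<alpha>) (path_target G \<alpha>)"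
  by (cases \<alpha>) (auto simp: FP_def path_target_def)

lemma FP_append_iff:
  "path_append \<alpha> p \<in> FP G \<longleftrightarrow> \<alpha> \<in> FP G \<and> (path_target G \<alpha>, p) \<in> FP G"
  by (cases \<alpha>) (auto simp: FP_def path_target_def path_append_def)

lemma path_target_append:
  assumes "path_append \<alpha> p \<in> FP G"
  shows "path_target G (path_append \<alpha> p) = path_target G (path_target G \<alpha>, p)"
  using assms
  by (cases \<alpha>) (auto simp: FP_def path_target_def path_append_def)

lemma path_target_vertex [simp]: "path_target G (vertex_path v) = v"
  by (simp add: path_target_def vertex_path_def)

lemma path_target_edge [simp]: "path_target G (edge_path G e) = head G e"
  by (simp add: path_target_def edge_path_def)

lemma vertex_in_FP [simp]: "vertex_path v \<in> FP G \<longleftrightarrow> v \<in> verts G"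
  by (auto simp: vertex_path_def FP_def awalk_Nil_iff)

lemma edge_in_FP [simp]: "e \<in> arcs G \<Longrightarrow> edge_path G e \<in> FP G"
  by (auto simp: edge_path_def FP_def awalk_def intro: wellformed)

lemma path_target_in_verts: "\<alpha> \<in> FP G \<Longrightarrow> path_target G \<alpha> \<in> verts G"
  by (auto simp: FP_iff)

lemma GPair_in_gis:
  "GPair \<alpha> \<beta> \<in> carrier (gis G)
    \<longleftrightarrow> \<alpha> \<in> FP G \<and> \<beta> \<in> FP G \<and> path_target G \<alpha> = path_target G \<beta>"
  by (simp add: gis_def del: split_paired_Ex)

lemma idem_in_gis [simp]: "idem \<alpha> \<in> carrier (gis G) \<longleftrightarrow> \<alpha> \<in> FP G"
  by (simp add: idem_def GPair_in_gis)

text \<open>If \<gamma> = \<beta>r, then r can be appended to \<alpha> as well, because \<alpha> and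
  \<beta> have the same target; likewise with \<delta> and \<gamma> in the other case.\<close>

lemma gis_mult_closed:
  assumes "s \<in> carrier (gis G)" "t \<in> carrier (gis G)"
  shows "gis_mult s t \<in> carrier (gis G)"
proof (cases "gis_mult s t = GZero")
  case False
  then obtain \<alpha> \<beta> \<gamma> \<delta> where st: "s = GPair \<alpha> \<beta>" "t = GPair \<gamma> \<delta>"
    by (metis gis.exhaust gis_mult.simps(2) gis_mult_GZero_right)
  have FP: "\<alpha> \<in> FP G" "\<beta> \<in> FP G" "\<gamma> \<in> FP G" "\<delta> \<in> FP G"
    and target: "path_target G \<alpha> = path_target G \<beta>" "path_target G \<gamma> = path_target G \<delta>"
    using assms st by (simp_all add: GPair_in_gis)
  show ?thesis
  proof (cases "path_prefix \<beta> \<gamma>")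
    case True
    then obtain r where r: "\<gamma> = path_append \<beta> r"
      by (auto simp: path_prefix_iff)
    then have "path_append \<alpha> r \<in> FP G"
      using FP target by (simp add: FP_append_iff)
    with r have "path_target G (path_append \<alpha> r) = path_target G \<delta>"
      using path_target_append FP target by metis
    with \<open>path_append \<alpha> r \<in> FP G\<close> show ?thesis
      using st r FP by (simp add: GPair_in_gis)
  next
    case nprefix: False
    then have "path_prefix \<gamma> \<beta>"
      using False st by (auto split: if_splits)
    then obtain r where r: "\<beta> = path_append \<gamma> r"
      by (auto simp: path_prefix_iff)
    then have "path_append \<delta> r \<in> FP G"
      using FP target by (simp add: FP_append_iff)
    with r have "path_target G (path_append \<delta> r) = path_target G \<alpha>"
      using path_target_append FP target by metis
    with \<open>path_append \<delta> r \<in> FP G\<close> show ?thesis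
      using st r FP nprefix by (simp add: GPair_in_gis)
  qed
qed (simp add: gis_def)

end

lemma GZero_in_gis [simp]: "GZero \<in> carrier (gis E)"
  by (simp add: gis_def)

lemma mult_gis [simp]: "s \<otimes>\<^bsub>gis E\<^esub> t = gis_mult s t"
  by (simp add: gis_def)

section \<open>Finite covers of a path\<close>

text \<open>
  \<open>X\<close> is the set of leaves of a finite tree with root \<open>\<beta>\<close>, grown by replacing a leaf that ends
  at a regular vertex by its one-edge extensions.
\<close>

inductive cover :: "('v, 'e) pre_digraph \<Rightarrow> ('v, 'e) fpath \<Rightarrow> ('v, 'e) fpath set \<Rightarrow> bool"
  for F where
  leaf: "cover F \<beta> {\<beta>}"
| node: "\<lbrakk>path_target F \<beta> \<in> regular_vertices F;
      \<And>f. f \<in> out_arcs F (path_target F \<beta>) \<Longrightarrow> cover F (path_append \<beta> [f]) (X f)\<rbrakk>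
    \<Longrightarrow> cover F \<beta> (\<Union>f\<in>out_arcs F (path_target F \<beta>). X f)"

lemma cover_prefix: "cover F \<beta> X \<Longrightarrow> \<xi> \<in> X \<Longrightarrow> path_prefix \<beta> \<xi>"
proof (induction arbitrary: \<xi> rule: cover.induct)
  case (node \<beta> X)
  then show ?case
    using path_prefix_trans path_prefix_append_self by blast
qed simp

lemma finite_cover: "cover F \<beta> X \<Longrightarrow> finite X"
  by (induction rule: cover.induct) (auto simp: regular_vertices_def)

context wf_digraph
begin

lemma append_arc_in_FP:
  assumes "\<beta> \<in> FP G" "f \<in> out_arcs G (path_target G \<beta>)"
  shows "path_append \<beta> [f] \<in> FP G"
  using assms edge_in_FP[of f] by (simp add: FP_append_iff edge_path_def)

lemma cover_subset_FP: "cover G \<beta> X \<Longrightarrow> \<beta> \<in> FP G \<Longrightarrow> X \<subseteq> FP G"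
proof (induction rule: cover.induct)
  case (node \<beta> X)
  then show ?case
    using append_arc_in_FP by blast
qed simp

lemma proper_extensionE:
  assumes "\<xi> \<in> FP G" "path_prefix \<beta> \<xi>" "\<xi> \<noteq> \<beta>"
  obtains f where "f \<in> out_arcs G (path_target G \<beta>)" "path_prefix (path_append \<beta> [f]) \<xi>"
proof -
  obtain p where p: "\<xi> = path_append \<beta> p"
    using assms by (auto simp: path_prefix_iff)
  then obtain f q where fq: "p = f # q"
    using assms by (cases p) auto
  have "f \<in> out_arcs G (path_target G \<beta>)"
    using assms(1) unfolding p fq FP_append_iff by (auto simp: FP_def awalk_Cons_iff)
  then show ?thesis
    using that p fq by simp
qed

text \<open>
  Regularity of the vertices at which the tree branches is forced: every edge leaving such a
  vertex starts an extension that has to meet the finite set \<open>X\<close>.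
\<close>

lemma coverI:
  assumes "\<beta> \<in> FP G" "finite X" "X \<subseteq> FP G"
    and "\<And>\<xi>. \<xi> \<in> X \<Longrightarrow> path_prefix \<beta> \<xi>"
    and "\<And>\<xi> \<eta>. \<xi> \<in> X \<Longrightarrow> \<eta> \<in> X \<Longrightarrow> path_prefix \<xi> \<eta> \<Longrightarrow> \<xi> = \<eta>"
    and "\<And>\<alpha>. \<alpha> \<in> FP G \<Longrightarrow> path_prefix \<beta> \<alpha> \<Longrightarrow> \<exists>\<xi>\<in>X. path_prefix \<alpha> \<xi> \<or> path_prefix \<xi> \<alpha>"
  shows "cover G \<beta> X"
proof -
  \<comment> \<open>The induction runs on a bound for how many edges the members of \<open>X\<close>
    may have beyond \<beta>. A bound on their full lengths is generous but enough to start.\<close>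
  obtain n where "\<forall>\<xi>\<in>X. length (snd \<xi>) \<le> n"
    using finite_nat_set_iff_bounded_le[of "(\<lambda>\<xi>. length (snd \<xi>)) ` X"] assms(2) by auto
  then have "\<forall>\<xi>\<in>X. length (snd \<xi>) \<le> length (snd \<beta>) + n"
    by (simp add: trans_le_add2)
  with assms show ?thesis
  proof (induction n arbitrary: \<beta> X)
    case (0 \<beta> X)
    have "\<xi> = \<beta>" if "\<xi> \<in> X" for \<xi>
      using 0(4,7) that by (fastforce simp: path_prefix_iff path_append_def prod_eq_iff)
    moreover have "X \<noteq> {}"
      using 0(6)[of \<beta>] 0(1) by auto
    ultimately have "X = {\<beta>}"
      by blast
    then show ?case
      by (simp add: cover.leaf)
  next
    case (Suc n \<beta> X)
    show ?case
    proof (cases "\<beta> \<in> X")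
      case True
      then have "X = {\<beta>}"
        using Suc.prems(4,5) by blast
      then show ?thesis
        by (simp add: cover.leaf)
    next
      case False
      let ?v = "path_target G \<beta>"
      \<comment> \<open>The members of \<open>X\<close> that leave \<beta> along \<open>f\<close>.
        As \<beta> itself is not in \<open>X\<close>, every member leaves along some edge.\<close>
      let ?X = "\<lambda>f. {\<xi> \<in> X. path_prefix (path_append \<beta> [f]) \<xi>}"
      have branch: "\<exists>f\<in>out_arcs G ?v. \<xi> \<in> ?X f" if "\<xi> \<in> X" for \<xi>
        using that False Suc.prems(3,4) by (metis (mono_tags, lifting) proper_extensionE mem_Collect_eq subsetD)
      have disjoint: "f = g" if "path_prefix (path_append \<beta> [f]) \<xi>" "path_prefix (path_append \<beta> [g]) \<xi>"
        for f g \<xi>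
        using path_prefix_same_cases[OF that] by auto
      have covers: "\<exists>\<xi>\<in>?X f. path_prefix \<alpha> \<xi> \<or> path_prefix \<xi> \<alpha>"
        if f: "f \<in> out_arcs G ?v" and \<alpha>: "\<alpha> \<in> FP G" "path_prefix (path_append \<beta> [f]) \<alpha>" for f \<alpha>
      proof -
        have "path_prefix \<beta> \<alpha>"
          using \<alpha> path_prefix_trans path_prefix_append_self by blast
        then obtain \<xi> where \<xi>: "\<xi> \<in> X" "path_prefix \<alpha> \<xi> \<or> path_prefix \<xi> \<alpha>"
          using Suc.prems(6) \<alpha>(1) by blast
        obtain g where g: "path_prefix (path_append \<beta> [g]) \<xi>"
          using branch \<xi>(1) by blast
        \<comment> \<open>Of the comparable paths \<alpha> and \<xi>, the longer one has both
          \<beta>f and \<beta>g as prefixes.\<close>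
        have "f = g"
          using \<xi>(2) g \<alpha>(2) disjoint path_prefix_trans by blast
        with \<xi> g show ?thesis
          by blast
      qed
      \<comment> \<open>Reading off the first edge after \<beta> maps the finite set
        \<open>X\<close> onto the edges leaving the vertex; by \<open>disjoint\<close> that edge is
        unique, so the choice is harmless.\<close>
      have "out_arcs G ?v \<subseteq> (\<lambda>\<xi>. SOME f. path_prefix (path_append \<beta> [f]) \<xi>) ` X"
      proof
        fix f assume f: "f \<in> out_arcs G ?v"
        then obtain \<xi> where \<xi>: "\<xi> \<in> X" "path_prefix (path_append \<beta> [f]) \<xi>"
          using covers[OF f append_arc_in_FP[OF Suc.prems(1) f]] by auto
        then have "(SOME g. path_prefix (path_append \<beta> [g]) \<xi>) = f"
          using disjoint by (intro some_equality)
        with \<xi>(1) show "f \<in> (\<lambda>\<xi>. SOME f. path_prefix (path_append \<beta> [f]) \<xi>) ` X"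
          by blast
      qed
      then have "finite (out_arcs G ?v)"
        using Suc.prems(2) by (rule finite_surj[rotated])
      \<comment> \<open>The covering hypothesis at \<alpha> = \<beta> yields a member of
        \<open>X\<close>, and \<open>branch\<close> an edge below it.\<close>
      moreover have "out_arcs G ?v \<noteq> {}"
        using Suc.prems(6)[of \<beta>] Suc.prems(1) branch by auto
      ultimately have "?v \<in> regular_vertices G"
        using path_target_in_verts[OF Suc.prems(1)] by (simp add: regular_vertices_def)
      moreover have "cover G (path_append \<beta> [f]) (?X f)" if f: "f \<in> out_arcs G ?v" for f
      proof (rule Suc.IH)
        show "path_append \<beta> [f] \<in> FP G"
          using Suc.prems(1) f by (rule append_arc_in_FP)
        \<comment> \<open>The absolute bound is unchanged: the root is one edge longer and n is one
          less.\<close>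
        show "\<forall>\<xi>\<in>?X f. length (snd \<xi>) \<le> length (snd (path_append \<beta> [f])) + n"
          using Suc.prems(7) by (auto simp: path_append_def)
        show "\<And>\<xi> \<eta>. \<xi> \<in> ?X f \<Longrightarrow> \<eta> \<in> ?X f \<Longrightarrow> path_prefix \<xi> \<eta> \<Longrightarrow> \<xi> = \<eta>"
          using Suc.prems(5) by simp
        show "\<And>\<alpha>. \<alpha> \<in> FP G \<Longrightarrow> path_prefix (path_append \<beta> [f]) \<alpha>
            \<Longrightarrow> \<exists>\<xi>\<in>?X f. path_prefix \<alpha> \<xi> \<or> path_prefix \<xi> \<alpha>"
          using f by (rule covers)
        show "finite (?X f)" "?X f \<subseteq> FP G"
          using Suc.prems(2,3) by auto
      qed simp
      ultimately have "cover G \<beta> (\<Union>f\<in>out_arcs G ?v. ?X f)"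
        by (rule cover.node)
      also have "(\<Union>f\<in>out_arcs G ?v. ?X f) = X"
        using branch by blast
      finally show ?thesis .
    qed
  qed
qed

text \<open>A common leaf would have \<beta>f and \<beta>g as prefixes. Disjointness is what lets
  sums over the subtrees be merged into one sum over the leaves.\<close>

lemma cover_disjoint:
  assumes "cover G (path_append \<beta> [f]) X" "cover G (path_append \<beta> [g]) Y" "f \<noteq> g"
  shows "disjnt X Y"
proof -
  have False if "\<xi> \<in> X" "\<xi> \<in> Y" for \<xi>
    using path_prefix_same_cases[OF cover_prefix[OF assms(1) that(1)] cover_prefix[OF assms(2) that(2)]]
      assms(3) by simp
  then show ?thesis
    by (auto simp: disjnt_def)
qed

lemma regular_in_verts: "v \<in> regular_vertices G \<Longrightarrow> v \<in> verts G"
  by (simp add: regular_vertices_def)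

lemma idem_vertex_in_gis: "v \<in> regular_vertices G \<Longrightarrow> idem (vertex_path v) \<in> carrier (gis G)"
  by (simp add: regular_vertices_def)

lemma idem_edge_in_gis: "e \<in> out_arcs G v \<Longrightarrow> idem (edge_path G e) \<in> carrier (gis G)"
  by simp

lemma vertex_mult_edge:
  assumes "e \<in> out_arcs G v"
  shows "gis_mult (idem (vertex_path v)) (idem (edge_path G e)) = idem (edge_path G e)"
  using assms by (auto simp: idem_mult_idem vertex_path_def edge_path_def path_prefix_def)

lemma edge_mult_vertex:
  assumes "e \<in> out_arcs G v"
  shows "gis_mult (idem (edge_path G e)) (idem (vertex_path v)) = idem (edge_path G e)"
  using assms by (auto simp: idem_mult_idem vertex_path_def edge_path_def path_prefix_def)

lemma edge_mult_edge:
  "e \<noteq> f \<Longrightarrow> gis_mult (idem (edge_path G e)) (idem (edge_path G f)) = GZero"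
  by (auto simp: idem_mult_idem edge_path_def path_prefix_def)

end

section \<open>Regular extended path homomorphisms\<close>

locale ext_path_hom = dom: wf_digraph E + cod: wf_digraph F for E F +
  fixes \<phi>
  assumes \<phi>: "\<phi> \<in> ext_path_homs E F"
begin

lemma map_GZero [simp]: "\<phi> GZero = GZero"
  and map_closed: "s \<in> carrier (gis E) \<Longrightarrow> \<phi> s \<in> carrier (gis F)"
  and map_mult: "s \<in> carrier (gis E) \<Longrightarrow> t \<in> carrier (gis E)
    \<Longrightarrow> \<phi> (gis_mult s t) = gis_mult (\<phi> s) (\<phi> t)"
  using \<phi> by (auto simp: ext_path_homs_def hom_def)

lemma map_idem_idempotent:
  "\<alpha> \<in> FP E \<Longrightarrow> gis_mult (\<phi> (idem \<alpha>)) (\<phi> (idem \<alpha>)) = \<phi> (idem \<alpha>)"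
  using map_mult[of "idem \<alpha>" "idem \<alpha>"] by (simp add: idem_mult_idem)

text \<open>Replaces the natural order by equations, which can be carried through the conjugations
  in \<open>cover_regular\<close>.\<close>

lemma regular_hom_iff:
  "regular_hom E F \<phi> \<longleftrightarrow>
    (\<forall>u\<in>regular_vertices E. \<forall>t\<in>carrier (gis F).
      t \<noteq> GZero \<and> gis_mult t t = t \<and> gis_mult t (\<phi> (idem (vertex_path u))) = t \<longrightarrow>
      (\<exists>e\<in>out_arcs E u. gis_mult t (\<phi> (idem (edge_path E e))) \<noteq> GZero))"
proof -
  have "gis_le t (\<phi> (idem (vertex_path u)))
    \<longleftrightarrow> gis_mult t t = t \<and> gis_mult t (\<phi> (idem (vertex_path u))) = t"
    if "u \<in> regular_vertices E" for u t
    using that by (intro gis_le_idempotent_iff map_idem_idempotent) (simp add: regular_vertices_def)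
  then show ?thesis
    unfolding regular_hom_def by blast
qed

end

locale regular_ext_path_hom = ext_path_hom +
  assumes regular: "regular_hom E F \<phi>"
begin

lemma regularE:
  assumes "u \<in> regular_vertices E" "t \<in> carrier (gis F)" "t \<noteq> GZero" "gis_mult t t = t"
    "gis_mult t (\<phi> (idem (vertex_path u))) = t"
  obtains e where "e \<in> out_arcs E u" "gis_mult t (\<phi> (idem (edge_path E e))) \<noteq> GZero"
  using assms regular unfolding regular_hom_iff by blast

text \<open>Checks the hypotheses of \<open>coverI\<close>: prefixes from (u, u)(e, e) = (e, e),
  incomparability from orthogonality of distinct edges, and the covering property from
  regularity.\<close>

lemma cover_map_edges:
  assumes u: "u \<in> regular_vertices E" and \<beta>: "\<phi> (idem (vertex_path u)) = idem \<beta>"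
  shows "cover F \<beta> {\<xi>. \<exists>e\<in>out_arcs E u. \<phi> (idem (edge_path E e)) = idem \<xi>}" (is "cover F \<beta> ?X")
proof (rule cod.coverI)
  have idem_FP: "\<xi> \<in> FP F" if "\<phi> s = idem \<xi>" "s \<in> carrier (gis E)" for \<xi> s
    using map_closed[OF that(2)] that(1) by simp
  show "\<beta> \<in> FP F"
    using idem_FP[OF \<beta>] dom.idem_vertex_in_gis[OF u] by simp
  show "?X \<subseteq> FP F"
    using idem_FP dom.idem_edge_in_gis by blast
  have "idem ` ?X \<subseteq> (\<lambda>e. \<phi> (idem (edge_path E e))) ` out_arcs E u"
    by force
  then have "finite (idem ` ?X)"
    using u by (auto simp: regular_vertices_def intro: finite_surj)
  then show "finite ?X"
    by (rule finite_imageD) (simp add: inj_on_def)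
next
  fix \<xi> assume "\<xi> \<in> ?X"
  then obtain e where e: "e \<in> out_arcs E u" "\<phi> (idem (edge_path E e)) = idem \<xi>"
    by blast
  then have "gis_mult (idem \<beta>) (idem \<xi>) = idem \<xi>"
    using map_mult[OF dom.idem_vertex_in_gis[OF u] dom.idem_edge_in_gis[OF e(1)]] \<beta>
      dom.vertex_mult_edge by simp
  then show "path_prefix \<beta> \<xi>"
    by (auto simp: idem_mult_idem split: if_splits)
next
  fix \<xi> \<eta> assume "\<xi> \<in> ?X" "\<eta> \<in> ?X" and prefix: "path_prefix \<xi> \<eta>"
  then obtain e f where e: "e \<in> out_arcs E u" "\<phi> (idem (edge_path E e)) = idem \<xi>"
    and f: "f \<in> out_arcs E u" "\<phi> (idem (edge_path E f)) = idem \<eta>"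
    by blast
  \<comment> \<open>Idempotents of comparable paths have a nonzero product, whereas those coming
    from distinct edges multiply to 0.\<close>
  have "gis_mult (idem \<xi>) (idem \<eta>) \<noteq> GZero"
    using prefix by (simp add: idem_mult_idem)
  then have "e = f"
    using map_mult[OF dom.idem_edge_in_gis[OF e(1)] dom.idem_edge_in_gis[OF f(1)]] e f
      dom.edge_mult_edge[of e f] by (metis map_GZero)
  with e f show "\<xi> = \<eta>"
    by simp
next
  \<comment> \<open>Regularity is tested on t = (\<alpha>, \<alpha>), which lies below (\<beta>,
    \<beta>).\<close>
  fix \<alpha> assume \<alpha>: "\<alpha> \<in> FP F" "path_prefix \<beta> \<alpha>"
  then have "gis_mult (idem \<alpha>) (idem \<beta>) = idem \<alpha>" "gis_mult (idem \<alpha>) (idem \<alpha>) = idem \<alpha>"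
    by (auto simp: idem_mult_idem dest: path_prefix_antisym)
  then obtain e where e: "e \<in> out_arcs E u"
    and nz: "gis_mult (idem \<alpha>) (\<phi> (idem (edge_path E e))) \<noteq> GZero"
    using regularE[OF u, of "idem \<alpha>"] \<alpha> \<beta> by auto
  have "gis_mult (\<phi> (idem (edge_path E e))) (\<phi> (idem (edge_path E e))) = \<phi> (idem (edge_path E e))"
    using e by (intro map_idem_idempotent) simp
  then obtain \<xi> where "\<phi> (idem (edge_path E e)) = idem \<xi>"
    using nz by (auto elim: idempotent_cases)
  moreover from this nz have "path_prefix \<alpha> \<xi> \<or> path_prefix \<xi> \<alpha>"
    by (auto simp: idem_mult_idem split: if_splits)
  ultimately show "\<exists>\<xi>\<in>?X. path_prefix \<alpha> \<xi> \<or> path_prefix \<xi> \<alpha>"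
    using e by blast
qed

text \<open>
  Conjugation by \<open>(\<beta>, v)\<close>, where \<open>v\<close> is the target of \<open>\<beta>\<close>, moves an element below
  \<open>\<phi>(\<beta>, \<beta>)\<close> to one below \<open>\<phi>(v, v)\<close>, where regularity applies.
\<close>

lemma cover_regular:
  assumes "cover E \<beta> X" "\<beta> \<in> FP E"
    and "t \<in> carrier (gis F)" "t \<noteq> GZero" "gis_mult t t = t" "gis_mult t (\<phi> (idem \<beta>)) = t"
  shows "\<exists>\<xi>\<in>X. gis_mult t (\<phi> (idem \<xi>)) \<noteq> GZero"
  using assms
proof (induction arbitrary: t rule: cover.induct)
  case (node \<beta> X)
  define v where "v = path_target E \<beta>"
  define a where "a = GPair \<beta> (vertex_path v)"
  define b where "b = GPair (vertex_path v) \<beta>"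
  have v: "v \<in> verts E"
    using node.prems(1) dom.path_target_in_verts by (simp add: v_def)
  have ab: "a \<in> carrier (gis E)" "b \<in> carrier (gis E)"
    using node.prems(1) v by (simp_all add: a_def b_def dom.GPair_in_gis v_def)
  have mult_ab: "gis_mult a b = idem \<beta>" "gis_mult b a = idem (vertex_path v)"
    by (simp_all add: a_def b_def idem_def)
  let ?\<phi> = "\<lambda>\<alpha>. \<phi> (idem \<alpha>)"
  have \<phi>_ab: "gis_mult (\<phi> a) (\<phi> b) = ?\<phi> \<beta>" "gis_mult (\<phi> b) (\<phi> a) = ?\<phi> (vertex_path v)"
    using ab by (simp_all flip: map_mult mult_ab)
  have idem_\<phi>: "gis_mult (?\<phi> \<alpha>) (?\<phi> \<alpha>) = ?\<phi> \<alpha>" if "\<alpha> \<in> FP E" for \<alpha>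
    using that by (rule map_idem_idempotent)
  have t\<beta>: "gis_mult (?\<phi> \<beta>) t = t"
    using idempotent_mult_commute[OF node.prems(4) idem_\<phi>[OF node.prems(1)]] node.prems(5) by simp
  define t' where "t' = gis_mult (\<phi> b) (gis_mult t (\<phi> a))"
  \<comment> \<open>\<phi>(\<beta>, \<beta>) = \<phi>(a)\<phi>(b) fixes t from both sides, so the
    conjugation can be undone; in particular \<open>t'\<close> is not 0.\<close>
  have t_eq: "gis_mult (\<phi> a) (gis_mult t' (\<phi> b)) = t"
    using \<phi>_ab t\<beta> node.prems(5) by (metis gis_mult_assoc t'_def)
  have "t' \<in> carrier (gis F)"
    using ab node.prems(2) by (simp add: t'_def cod.gis_mult_closed map_closed)
  moreover have "t' \<noteq> GZero"
    using t_eq node.prems(3) by auto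
  moreover have "gis_mult t' t' = t'"
    using \<phi>_ab t\<beta> node.prems(4,5) by (metis gis_mult_assoc t'_def)
  moreover have "gis_mult t' (?\<phi> (vertex_path v)) = t'"
    using \<phi>_ab node.prems(5) by (metis gis_mult_assoc t'_def)
  ultimately obtain f where f: "f \<in> out_arcs E v" "gis_mult t' (?\<phi> (edge_path E f)) \<noteq> GZero"
    using regularE node.hyps(1) unfolding v_def by blast
  let ?\<beta>f = "path_append \<beta> [f]"
  have \<beta>f: "?\<beta>f \<in> FP E"
    using node.prems(1) f dom.append_arc_in_FP by (simp add: v_def)
  have "gis_mult a (gis_mult (idem (edge_path E f)) b) = idem ?\<beta>f"
    using f(1) by (auto simp: a_def b_def idem_def vertex_path_def edge_path_def path_prefix_def
        path_rest_def path_append_def)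
  then have \<phi>_f: "gis_mult (\<phi> a) (gis_mult (?\<phi> (edge_path E f)) (\<phi> b)) = ?\<phi> ?\<beta>f"
    using ab dom.idem_edge_in_gis[OF f(1)] by (simp add: dom.gis_mult_closed flip: map_mult)
  \<comment> \<open>The part of t below \<phi>(\<beta>f, \<beta>f), to which the induction
    hypothesis for the subtree at \<beta>f applies once it is known not to vanish.\<close>
  define t'' where "t'' = gis_mult t (?\<phi> ?\<beta>f)"
  have "gis_mult (?\<phi> (edge_path E f)) (?\<phi> (vertex_path v)) = ?\<phi> (edge_path E f)"
    using map_mult[OF dom.idem_edge_in_gis[OF f(1)], of "idem (vertex_path v)"] v
      dom.edge_mult_vertex[OF f(1)] by simp
  \<comment> \<open>Conjugating \<open>t''\<close> down to v gives the product of \<open>t'\<close>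
    with \<phi>(f, f), which regularity at v made nonzero.\<close>
  then have conj: "gis_mult (\<phi> b) (gis_mult t'' (\<phi> a)) = gis_mult t' (?\<phi> (edge_path E f))"
    unfolding t''_def t'_def \<phi>_f[symmetric] by (metis gis_mult_assoc \<phi>_ab(2))
  have "t'' \<in> carrier (gis F)"
    using node.prems(2) \<beta>f by (simp add: t''_def cod.gis_mult_closed map_closed)
  moreover have "t'' \<noteq> GZero"
    using conj f(2) by auto
  moreover have comm: "gis_mult (?\<phi> ?\<beta>f) t = t''"
    using idempotent_mult_commute[OF node.prems(4) idem_\<phi>[OF \<beta>f]] by (simp add: t''_def)
  moreover have below: "gis_mult t'' (?\<phi> ?\<beta>f) = t''"
    by (simp add: t''_def gis_mult_assoc idem_\<phi>[OF \<beta>f])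
  moreover have "gis_mult t'' t'' = t''"
    using node.prems(4) comm below by (metis gis_mult_assoc t''_def)
  ultimately obtain \<xi> where \<xi>: "\<xi> \<in> X f" "gis_mult t'' (?\<phi> \<xi>) \<noteq> GZero"
    using node.IH[of f t''] f(1) \<beta>f by (auto simp: v_def)
  have cov: "cover E ?\<beta>f (X f)"
    using node.hyps(2) f(1) by (simp add: v_def)
  \<comment> \<open>Since \<xi> extends \<beta>f, multiplying \<open>t''\<close> by \<phi>(\<xi>,
    \<xi>) is the same as multiplying t by it, so the leaf found for \<open>t''\<close> also serves
    t.\<close>
  have "gis_mult (?\<phi> ?\<beta>f) (?\<phi> \<xi>) = ?\<phi> \<xi>"
    using map_mult[of "idem ?\<beta>f" "idem \<xi>"] \<beta>f \<xi>(1) dom.cover_subset_FP[OF cov \<beta>f]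
      cover_prefix[OF cov \<xi>(1)] by (auto simp: idem_mult_idem)
  then have "gis_mult t (?\<phi> \<xi>) \<noteq> GZero"
    using \<xi>(2) by (simp add: t''_def gis_mult_assoc)
  then show ?case
    using \<xi>(1) f(1) by (auto simp: v_def)
qed simp

end

section \<open>Composites and identities of regular homomorphisms; the category
  \<open>REG\<close>\<close>

lemma ext_path_hom_compose:
  assumes "ext_path_hom E F \<phi>" "ext_path_hom F G \<psi>"
  shows "ext_path_hom E G (compose (carrier (gis E)) \<psi> \<phi>)"
proof -
  interpret \<phi>: ext_path_hom E F \<phi> by fact
  interpret \<psi>: ext_path_hom F G \<psi> by fact
  show ?thesis
    by unfold_locales
      (auto simp: ext_path_homs_def hom_def compose_def \<phi>.map_closed \<psi>.map_closed \<phi>.map_mult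
        \<psi>.map_mult \<phi>.dom.gis_mult_closed)
qed

text \<open>Regularity of \<phi> makes the nonzero images of the edges at u the leaves of a cover in
  \<open>F\<close>, and \<open>cover_regular\<close> for \<psi> finds one of these leaves whose
  image meets t.\<close>

lemma regular_ext_path_hom_compose:
  assumes "regular_ext_path_hom E F \<phi>" "regular_ext_path_hom F G \<psi>"
  shows "regular_ext_path_hom E G (compose (carrier (gis E)) \<psi> \<phi>)"
proof -
  interpret \<phi>: regular_ext_path_hom E F \<phi> by fact
  interpret \<psi>: regular_ext_path_hom F G \<psi> by fact
  interpret ext_path_hom E G "compose (carrier (gis E)) \<psi> \<phi>"
    using \<phi>.ext_path_hom_axioms \<psi>.ext_path_hom_axioms by (rule ext_path_hom_compose)
  have "\<exists>e\<in>out_arcs E u. gis_mult t (\<psi> (\<phi> (idem (edge_path E e)))) \<noteq> GZero"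
    if u: "u \<in> regular_vertices E"
      and t: "t \<in> carrier (gis G)" "t \<noteq> GZero" "gis_mult t t = t"
        "gis_mult t (\<psi> (\<phi> (idem (vertex_path u)))) = t" for u t
  proof -
    have u_in: "idem (vertex_path u) \<in> carrier (gis E)"
      using u by (rule \<phi>.dom.idem_vertex_in_gis)
    have "gis_mult (\<phi> (idem (vertex_path u))) (\<phi> (idem (vertex_path u)))
        = \<phi> (idem (vertex_path u))"
      using u_in by (intro \<phi>.map_idem_idempotent) simp
    moreover have "\<phi> (idem (vertex_path u)) \<noteq> GZero"
      using t(2,4) by auto
    ultimately obtain \<beta> where \<beta>: "\<phi> (idem (vertex_path u)) = idem \<beta>"
      by (auto elim: idempotent_cases)
    have "\<beta> \<in> FP F"
      using \<phi>.map_closed[OF u_in] \<beta> by simp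
    then obtain \<xi> where "\<exists>e\<in>out_arcs E u. \<phi> (idem (edge_path E e)) = idem \<xi>"
      and "gis_mult t (\<psi> (idem \<xi>)) \<noteq> GZero"
      using \<psi>.cover_regular[OF \<phi>.cover_map_edges[OF u \<beta>], of t] t \<beta> by auto
    then show ?thesis
      by metis
  qed
  then show ?thesis
    by unfold_locales (simp add: regular_hom_iff compose_eq \<phi>.dom.regular_in_verts)
qed

text \<open>A nonzero idempotent below (u, u) is that of a path \<alpha> starting at u. If \<alpha>
  = u, any edge at u will do, and one exists by regularity of u; otherwise the first edge of
  \<alpha> does.\<close>

lemma regular_ext_path_hom_ident:
  assumes "wf_digraph E"
  shows "regular_ext_path_hom E E (\<lambda>t \<in> carrier (gis E). t)"
proof -
  interpret wf_digraph E by fact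
  interpret ext_path_hom E E "\<lambda>t \<in> carrier (gis E). t"
    by unfold_locales (auto simp: ext_path_homs_def hom_def gis_mult_closed)
  have "\<exists>e\<in>out_arcs E u. gis_mult t (idem (edge_path E e)) \<noteq> GZero"
    if u: "u \<in> regular_vertices E" and t: "t \<in> carrier (gis E)" "t \<noteq> GZero" "gis_mult t t = t"
      "gis_mult t (idem (vertex_path u)) = t" for u t
  proof -
    obtain \<alpha> where \<alpha>: "t = idem \<alpha>"
      using t(2,3) by (auto elim: idempotent_cases)
    have prefix: "path_prefix (vertex_path u) \<alpha>"
      using t(4) unfolding \<alpha> idem_mult_idem by (auto split: if_splits)
    have "\<exists>e\<in>out_arcs E u. path_prefix \<alpha> (edge_path E e) \<or> path_prefix (edge_path E e) \<alpha>"
    proof (cases "\<alpha> = vertex_path u")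
      case True
      obtain e where "e \<in> out_arcs E u"
        using u unfolding regular_vertices_def by blast
      then show ?thesis
        using True by (auto simp: vertex_path_def edge_path_def path_prefix_def)
    next
      case False
      moreover have "\<alpha> \<in> FP E"
        using t(1) \<alpha> by simp
      ultimately obtain e where e: "e \<in> out_arcs E u"
        and "path_prefix (path_append (vertex_path u) [e]) \<alpha>"
        using prefix by (metis proper_extensionE path_target_vertex)
      moreover have "path_append (vertex_path u) [e] = edge_path E e"
        using e by (simp add: vertex_path_def edge_path_def path_append_def)
      ultimately show ?thesis
        by auto
    qed
    then show ?thesis
      unfolding \<alpha> idem_mult_idem by auto
  qed
  then show ?thesis
    by unfold_locales (simp add: regular_hom_iff regular_in_verts)
qed

lemma Mor_REG_iff:
  "E \<in> Ob REG \<Longrightarrow> F \<in> Ob REG \<Longrightarrow> \<phi> \<in> Mor REG E F \<longleftrightarrow> regular_ext_path_hom E F \<phi>"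
  by (auto simp: REG_def regular_ext_path_hom_def regular_ext_path_hom_axioms_def
      ext_path_hom_def ext_path_hom_axioms_def)

lemma category_REG: "category (REG :: (('v, 'e) pre_digraph, _) category_data)"
proof
  fix E :: "('v, 'e) pre_digraph"
  assume "E \<in> Ob REG"
  then show "Ident REG E \<in> Mor REG E E"
    by (subst Mor_REG_iff) (simp_all add: REG_def regular_ext_path_hom_ident)
next
  fix E F G :: "('v, 'e) pre_digraph" and \<phi> \<psi>
  assume "E \<in> Ob REG" "F \<in> Ob REG" "G \<in> Ob REG" "\<phi> \<in> Mor REG E F" "\<psi> \<in> Mor REG F G"
  then have "regular_ext_path_hom E G (compose (carrier (gis E)) \<psi> \<phi>)"
    using regular_ext_path_hom_compose by (simp add: Mor_REG_iff)
  with \<open>E \<in> Ob REG\<close> \<open>G \<in> Ob REG\<close> show "Comp REG E F G \<psi> \<phi> \<in> Mor REG E G"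
    by (subst Mor_REG_iff) (simp_all add: REG_def)
next
  fix D E F G :: "('v, 'e) pre_digraph" and \<phi> \<psi> \<chi>
  assume "\<phi> \<in> Mor REG D E"
  then show "Comp REG D F G \<chi> (Comp REG D E F \<psi> \<phi>) = Comp REG D E G (Comp REG E F G \<chi> \<psi>) \<phi>"
    by (auto simp: REG_def ext_path_homs_def hom_def Pi_iff compose_def fun_eq_iff restrict_def)
next
  fix E F :: "('v, 'e) pre_digraph" and \<phi>
  assume "\<phi> \<in> Mor REG E F"
  then show "Comp REG E F F (Ident REG F) \<phi> = \<phi>" "Comp REG E E F \<phi> (Ident REG E) = \<phi>"
    by (auto simp: REG_def ext_path_homs_def hom_def Pi_iff compose_def fun_eq_iff extensional_def)
qed

section \<open>Leavitt path algebras\<close>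

text \<open>The relations satisfied by the classes of the elements of S(F) in the Leavitt algebra,
  isolated so that sums over covers are computed without cosets. \<open>T_vertex\<close> is the
  defining relation, (e, e) being the product of (e, v) and (v, e) for v the target of e.\<close>

locale leavitt_family = k_algebra K A + F?: wf_digraph F
  for K :: "('k, 'm) ring_scheme" (structure) and A (structure)
    and F :: "('w, 'f) pre_digraph" +
  fixes T :: "('w, 'f) gis \<Rightarrow> 'a"
  assumes T_closed: "s \<in> carrier (gis F) \<Longrightarrow> T s \<in> carrier A"
    and T_mult: "\<lbrakk>s \<in> carrier (gis F); t \<in> carrier (gis F)\<rbrakk> \<Longrightarrow> T (gis_mult s t) = T s \<otimes>\<^bsub>A\<^esub> T t"
    and T_GZero: "T GZero = \<zero>\<^bsub>A\<^esub>"
    and T_vertex: "v \<in> regular_vertices F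
      \<Longrightarrow> T (idem (vertex_path v)) = (\<Oplus>\<^bsub>A\<^esub>e\<in>out_arcs F v. T (idem (edge_path F e)))"
begin

text \<open>The relation at the target v of \<beta>, multiplied by \<open>T a\<close> on the left
  and \<open>T b\<close> on the right, becomes a relation at \<beta>, each (f, f) turning into
  (\<beta>f, \<beta>f). The induction hypothesis expands every term over its subtree.\<close>

lemma T_cover:
  assumes "cover F \<beta> X" "\<beta> \<in> FP F"
  shows "T (idem \<beta>) = (\<Oplus>\<^bsub>A\<^esub>\<xi>\<in>X. T (idem \<xi>))"
  using assms
proof (induction rule: cover.induct)
  case (leaf \<beta>)
  then show ?case
    by (simp add: T_closed)
next
  case (node \<beta> X)
  define v where "v = path_target F \<beta>"
  define a where "a = GPair \<beta> (vertex_path v)"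
  define b where "b = GPair (vertex_path v) \<beta>"
  have v: "v \<in> regular_vertices F" "v \<in> verts F" "finite (out_arcs F v)"
    using node.hyps(1) by (simp_all add: v_def regular_vertices_def)
  have ab: "a \<in> carrier (gis F)" "b \<in> carrier (gis F)"
    using node.prems v by (simp_all add: a_def b_def GPair_in_gis v_def)
  have ext: "path_append \<beta> [f] \<in> FP F" if "f \<in> out_arcs F v" for f
    using node.prems that append_arc_in_FP by (simp add: v_def)
  have cov: "cover F (path_append \<beta> [f]) (X f)" if "f \<in> out_arcs F v" for f
    using node.hyps(2) that by (simp add: v_def)
  have T_leaf: "T (idem \<xi>) \<in> carrier A" if "f \<in> out_arcs F v" "\<xi> \<in> X f" for f \<xi>
    using T_closed[of "idem \<xi>"] cover_subset_FP[OF cov[OF that(1)] ext[OF that(1)]] that(2) by auto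
  have idem_\<beta>: "idem \<beta> = gis_mult a (gis_mult (idem (vertex_path v)) b)"
    by (simp add: a_def b_def idem_def)
  have idem_ext: "gis_mult a (gis_mult (idem (edge_path F f)) b) = idem (path_append \<beta> [f])"
    if "f \<in> out_arcs F v" for f
    using that by (auto simp: a_def b_def idem_def vertex_path_def edge_path_def path_prefix_def
        path_rest_def path_append_def)
  have T_edge: "T (idem (edge_path F f)) \<in> carrier A" if "f \<in> out_arcs F v" for f
    using idem_edge_in_gis[OF that] by (rule T_closed)
  have "T (idem \<beta>) = T a \<otimes>\<^bsub>A\<^esub> (T (idem (vertex_path v)) \<otimes>\<^bsub>A\<^esub> T b)"
    unfolding idem_\<beta> using ab v(2) by (simp add: T_mult gis_mult_closed)
  also have "\<dots> = (\<Oplus>\<^bsub>A\<^esub>f\<in>out_arcs F v. T a \<otimes>\<^bsub>A\<^esub> (T (idem (edge_path F f)) \<otimes>\<^bsub>A\<^esub> T b))"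
    using ab v T_edge T_closed
    by (simp add: T_vertex mult_finsum_left mult_finsum_right Pi_def mult_closed)
  also have "\<dots> = (\<Oplus>\<^bsub>A\<^esub>f\<in>out_arcs F v. T (idem (path_append \<beta> [f])))"
  proof (rule M.finsum_cong')
    fix f assume f: "f \<in> out_arcs F v"
    show "T a \<otimes>\<^bsub>A\<^esub> (T (idem (edge_path F f)) \<otimes>\<^bsub>A\<^esub> T b) = T (idem (path_append \<beta> [f]))"
      using ab idem_edge_in_gis[OF f]
      unfolding idem_ext[OF f, symmetric] by (simp only: T_mult gis_mult_closed)
  qed (use ext T_closed in auto)
  also have "\<dots> = (\<Oplus>\<^bsub>A\<^esub>f\<in>out_arcs F v. \<Oplus>\<^bsub>A\<^esub>\<xi>\<in>X f. T (idem \<xi>))"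
  proof (rule M.finsum_cong')
    fix f assume f: "f \<in> out_arcs F v"
    then show "T (idem (path_append \<beta> [f])) = (\<Oplus>\<^bsub>A\<^esub>\<xi>\<in>X f. T (idem \<xi>))"
      using node.IH[of f] ext[OF f] by (simp add: v_def)
  next
    show "(\<lambda>f. \<Oplus>\<^bsub>A\<^esub>\<xi>\<in>X f. T (idem \<xi>)) \<in> out_arcs F v \<rightarrow> carrier A"
      using T_leaf by (intro Pi_I M.finsum_closed)
  qed simp
  also have "\<dots> = (\<Oplus>\<^bsub>A\<^esub>\<xi>\<in>(\<Union>f\<in>out_arcs F v. X f). T (idem \<xi>))"
  proof (rule M.add.finprod_UN_disjoint[symmetric])
    show "pairwise (\<lambda>f g. disjnt (X f) (X g)) (out_arcs F v)"
      by (intro pairwiseI cover_disjoint[OF cov cov])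
    show "finite (X f)" if "f \<in> out_arcs F v" for f
      using cov[OF that] by (rule finite_cover)
  qed (use v(3) T_leaf in blast)+
  finally show ?case
    by (simp add: v_def)
qed

text \<open>\<open>T_cover\<close> for the cover given by the edges at u; what remains is to pass
  from its set of leaves to a sum indexed by edges.\<close>

lemma T_regular_hom:
  assumes "regular_ext_path_hom E F \<phi>" and u: "u \<in> regular_vertices E"
  shows "T (\<phi> (idem (vertex_path u)))
    = (\<Oplus>\<^bsub>A\<^esub>e\<in>out_arcs E u. T (\<phi> (idem (edge_path E e))))"
proof -
  interpret \<phi>: regular_ext_path_hom E F \<phi> by fact
  let ?f = "\<lambda>e. \<phi> (idem (edge_path E e))"
  have u_in: "idem (vertex_path u) \<in> carrier (gis E)"
    using u by (rule \<phi>.dom.idem_vertex_in_gis)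
  have f_in: "?f e \<in> carrier (gis F)" if "e \<in> out_arcs E u" for e
    using \<phi>.dom.idem_edge_in_gis[OF that] by (rule \<phi>.map_closed)
  have idem_f: "gis_mult (?f e) (?f e) = ?f e" if "e \<in> out_arcs E u" for e
    using \<phi>.dom.idem_edge_in_gis[OF that] by (intro \<phi>.map_idem_idempotent) simp
  have f_u: "?f e = gis_mult (\<phi> (idem (vertex_path u))) (?f e)" if "e \<in> out_arcs E u" for e
    using \<phi>.map_mult[OF u_in \<phi>.dom.idem_edge_in_gis[OF that]] \<phi>.dom.vertex_mult_edge[OF that]
    by simp
  have "gis_mult (\<phi> (idem (vertex_path u))) (\<phi> (idem (vertex_path u))) = \<phi> (idem (vertex_path u))"
    using u_in by (intro \<phi>.map_idem_idempotent) simp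
  then show ?thesis
  proof (cases rule: idempotent_cases)
    case 1
    then have "?f e = GZero" if "e \<in> out_arcs E u" for e
      using f_u[OF that] by simp
    then have "(\<Oplus>\<^bsub>A\<^esub>e\<in>out_arcs E u. T (?f e)) = \<zero>\<^bsub>A\<^esub>"
      by (intro M.add.finprod_one_eqI) (simp only: T_GZero)
    then show ?thesis
      using 1 by (simp only: T_GZero)
  next
    case (2 \<beta>)
    let ?X = "{\<xi>. \<exists>e\<in>out_arcs E u. ?f e = idem \<xi>}"
    \<comment> \<open>Edges with image 0 contribute nothing to the sum; the others correspond to the
      leaves through \<open>g\<close>.\<close>
    let ?D = "{e \<in> out_arcs E u. ?f e \<noteq> GZero}"
    define g where "g e = (THE \<xi>. ?f e = idem \<xi>)" for e
    have g: "?f e = idem (g e)" if "e \<in> ?D" for e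
    proof -
      have "gis_mult (?f e) (?f e) = ?f e" "?f e \<noteq> GZero"
        using that idem_f by simp_all
      then obtain \<xi> where "?f e = idem \<xi>"
        by (auto elim: idempotent_cases)
      then show ?thesis
        by (simp add: g_def)
    qed
    have "\<beta> \<in> FP F"
      using \<phi>.map_closed[OF u_in] 2 by simp
    have X: "?X = g ` ?D"
      using g by (force simp: image_iff)
    \<comment> \<open>Two distinct edges with the same leaf would have images with nonzero product,
      against orthogonality.\<close>
    have "inj_on g ?D"
    proof (rule inj_onI)
      fix e f assume e: "e \<in> ?D" and f: "f \<in> ?D" and "g e = g f"
      then have "gis_mult (?f e) (?f f) \<noteq> GZero"
        using g idem_f by (metis (mono_tags, lifting) idem_neq_GZero(1) mem_Collect_eq)
      then show "e = f"
        using \<phi>.map_mult[of "idem (edge_path E e)" "idem (edge_path E f)"] e f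
          \<phi>.dom.idem_edge_in_gis \<phi>.dom.edge_mult_edge[of e f] \<phi>.map_GZero
        by (metis (mono_tags, lifting) mem_Collect_eq)
    qed
    have "T (idem \<beta>) = (\<Oplus>\<^bsub>A\<^esub>\<xi>\<in>g ` ?D. T (idem \<xi>))"
      using T_cover[OF \<phi>.cover_map_edges[OF u 2] \<open>\<beta> \<in> FP F\<close>] unfolding X .
    also have "\<dots> = (\<Oplus>\<^bsub>A\<^esub>e\<in>?D. T (idem (g e)))"
    proof (rule M.finsum_reindex[OF _ \<open>inj_on g ?D\<close>])
      show "(\<lambda>\<xi>. T (idem \<xi>)) \<in> g ` ?D \<rightarrow> carrier A"
        using g f_in by (auto intro!: T_closed simp del: idem_in_gis)
    qed
    also have "\<dots> = (\<Oplus>\<^bsub>A\<^esub>e\<in>out_arcs E u. T (?f e))"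
    proof (rule M.add.finprod_mono_neutral_cong_left)
      show "finite (out_arcs E u)"
        using u by (simp add: regular_vertices_def)
      show "T (?f e) = \<zero>\<^bsub>A\<^esub>" if "e \<in> out_arcs E u - ?D" for e
        using that T_GZero by fastforce
      show "T (idem (g e)) = T (?f e)" if "e \<in> ?D" for e
        using g[OF that] by simp
      show "(\<lambda>e. T (?f e)) \<in> out_arcs E u \<rightarrow> carrier A"
        using f_in T_closed by blast
    qed blast
    finally show ?thesis
      using 2 by simp
  qed
qed

end

section \<open>The Cohn and Leavitt algebras of one graph\<close>

locale path_algebra = K: cring K + wf_digraph E
  for K :: "('k, 'm) ring_scheme" (structure) and E :: "('v, 'e) pre_digraph"
begin

sublocale S: semigroup_alg K "gis E"
  by unfold_locales (auto simp: gis_mult_closed gis_mult_assoc)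

sublocale KS: k_algebra_ideal K S.KS "zero_span K E"
proof -
  interpret KS: nonunital_algebra K S.KS
    by (simp add: nonunital_algebra_iff S.k_algebra_KS)
  let ?z = "S.bas GZero"
  have z: "?z \<in> carrier S.KS"
    by (rule S.basis_in)
  \<comment> \<open>The scalar amounts to the sum of the coefficients of \<open>x\<close>: a product
    of any basis element with that of 0 is the latter, whence the witness 1 in the basis
    case.\<close>
  have mult_z: "\<exists>c\<in>carrier K. x \<otimes>\<^bsub>S.KS\<^esub> ?z = c \<odot>\<^bsub>S.KS\<^esub> ?z"
    "\<exists>c\<in>carrier K. ?z \<otimes>\<^bsub>S.KS\<^esub> x = c \<odot>\<^bsub>S.KS\<^esub> ?z" if "x \<in> carrier S.KS" for x
  proof -
    show "\<exists>c\<in>carrier K. x \<otimes>\<^bsub>S.KS\<^esub> ?z = c \<odot>\<^bsub>S.KS\<^esub> ?z"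
      using that
    proof (induction x rule: S.KS_induct)
      case zero
      then show ?case
        using z by (intro bexI[of _ \<zero>]) (simp_all add: KS.mult_zero_left)
    next
      case (basis s)
      then show ?case
        using z by (intro bexI[of _ \<one>]) (simp_all add: S.mult_basis)
    next
      case (add f g)
      then show ?case
        using z by (metis KS.mult_l_distr KS.smult_l_distr K.a_closed)
    next
      case (smult c f)
      then show ?case
        using z by (metis KS.smult_mult_l KS.smult_assoc1 K.m_closed)
    qed
    show "\<exists>c\<in>carrier K. ?z \<otimes>\<^bsub>S.KS\<^esub> x = c \<odot>\<^bsub>S.KS\<^esub> ?z"
      using that
    proof (induction x rule: S.KS_induct)
      case zero
      then show ?case
        using z by (intro bexI[of _ \<zero>]) (simp_all add: KS.mult_zero_right)
    next
      case (basis s)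
      then show ?case
        using z by (intro bexI[of _ \<one>]) (simp_all add: S.mult_basis)
    next
      case (add f g)
      then show ?case
        using z by (metis KS.mult_r_distr KS.smult_l_distr K.a_closed)
    next
      case (smult c f)
      then show ?case
        using z by (metis KS.smult_mult_r KS.smult_assoc1 K.m_closed)
    qed
  qed
  have "k_ideal K S.KS (zero_span K E)"
  proof (rule KS.k_idealI)
    show "\<zero>\<^bsub>S.KS\<^esub> \<in> zero_span K E"
      unfolding zero_span_def using z KS.smult_l_null K.zero_closed
      by (metis (mono_tags, lifting) mem_Collect_eq)
    show "x \<oplus>\<^bsub>S.KS\<^esub> y \<in> zero_span K E" if "x \<in> zero_span K E" "y \<in> zero_span K E" for x y
      using that z KS.smult_l_distr K.a_closed unfolding zero_span_def
      by (smt (verit) mem_Collect_eq)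
    show "c \<odot>\<^bsub>S.KS\<^esub> x \<in> zero_span K E" if "c \<in> carrier K" "x \<in> zero_span K E" for c x
      using that z KS.smult_assoc1 K.m_closed unfolding zero_span_def
      by (smt (verit) mem_Collect_eq)
    show "x \<otimes>\<^bsub>S.KS\<^esub> i \<in> zero_span K E" "i \<otimes>\<^bsub>S.KS\<^esub> x \<in> zero_span K E"
      if x: "x \<in> carrier S.KS" and i: "i \<in> zero_span K E" for x i
    proof -
      obtain c where c: "c \<in> carrier K" "i = c \<odot>\<^bsub>S.KS\<^esub> ?z"
        using i by (auto simp: zero_span_def)
      obtain l r where "l \<in> carrier K" "x \<otimes>\<^bsub>S.KS\<^esub> ?z = l \<odot>\<^bsub>S.KS\<^esub> ?z"
        and "r \<in> carrier K" "?z \<otimes>\<^bsub>S.KS\<^esub> x = r \<odot>\<^bsub>S.KS\<^esub> ?z"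
        using mult_z[OF x] by blast
      with c x z have "x \<otimes>\<^bsub>S.KS\<^esub> i = (c \<otimes> l) \<odot>\<^bsub>S.KS\<^esub> ?z"
        "i \<otimes>\<^bsub>S.KS\<^esub> x = (c \<otimes> r) \<odot>\<^bsub>S.KS\<^esub> ?z" "c \<otimes> l \<in> carrier K" "c \<otimes> r \<in> carrier K"
        by (simp_all add: KS.smult_mult_l KS.smult_mult_r KS.smult_assoc1)
      then show "x \<otimes>\<^bsub>S.KS\<^esub> i \<in> zero_span K E" "i \<otimes>\<^bsub>S.KS\<^esub> x \<in> zero_span K E"
        unfolding zero_span_def by blast+
    qed
  qed (auto simp: zero_span_def z)
  then show "k_algebra_ideal K S.KS (zero_span K E)"
    by unfold_locales
qed

abbreviation C where "C \<equiv> cohn K E"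
abbreviation C_elem where "C_elem \<equiv> cohn_elem K E"
abbreviation C_sum where "C_sum u \<equiv> \<Oplus>\<^bsub>C\<^esub>e\<in>out_arcs E u. C_elem (idem (edge_path E e))"

sublocale C: nonunital_algebra K C
  using KS.k_algebra_k_quotient by (simp add: nonunital_algebra_iff cohn_def)

lemma C_elem_closed: "C_elem t \<in> carrier C"
  by (simp add: cohn_def cohn_elem_def KS.coset_closed S.basis_in)

lemma C_elem_mult:
  "s \<in> carrier (gis E) \<Longrightarrow> t \<in> carrier (gis E) \<Longrightarrow> C_elem (gis_mult s t) = C_elem s \<otimes>\<^bsub>C\<^esub> C_elem t"
  by (simp add: cohn_def cohn_elem_def KS.mult_coset S.basis_in S.mult_basis)

lemma C_elem_GZero: "C_elem GZero = \<zero>\<^bsub>C\<^esub>"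
proof -
  have "S.bas GZero = \<one> \<odot>\<^bsub>S.KS\<^esub> S.bas GZero"
    by (simp add: S.basis_in)
  then have "S.bas GZero \<in> zero_span K E"
    unfolding zero_span_def by blast
  then show ?thesis
    by (simp add: cohn_def cohn_elem_def KS.coset_eq_zero_iff S.basis_in)
qed

text \<open>Rewrites the generators in terms of idempotents: for v the target of e, (e, v)(v, e) =
  (e, e) in S(E).\<close>

lemma leavitt_ideal_eq:
  "leavitt_ideal K E
    = k_ideal_gen K C {C_elem (idem (vertex_path u)) \<ominus>\<^bsub>C\<^esub> C_sum u |u. u \<in> regular_vertices E}"
proof -
  have "cohn_path K E (vertex_path u) = C_elem (idem (vertex_path u))" for u
    by (simp add: cohn_path_def idem_def)
  moreover have "(\<Oplus>\<^bsub>C\<^esub>e\<in>out_arcs E u.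
      cohn_path K E (edge_path E e) \<otimes>\<^bsub>C\<^esub> cohn_path_star K E (edge_path E e)) = C_sum u" for u
  proof (rule C.M.finsum_cong')
    fix e assume "e \<in> out_arcs E u"
    then show "cohn_path K E (edge_path E e) \<otimes>\<^bsub>C\<^esub> cohn_path_star K E (edge_path E e)
        = C_elem (idem (edge_path E e))"
      by (simp add: cohn_path_def cohn_path_star_def GPair_in_gis idem_def flip: C_elem_mult)
  qed (simp_all add: C_elem_closed)
  ultimately show ?thesis
    by (simp add: leavitt_ideal_def)
qed

lemma relation_closed: "C_elem t \<ominus>\<^bsub>C\<^esub> C_sum u \<in> carrier C"
  by (intro C.M.minus_closed C.M.finsum_closed C_elem_closed Pi_I)

lemma relations_subset:
  "{C_elem (idem (vertex_path u)) \<ominus>\<^bsub>C\<^esub> C_sum u |u. u \<in> regular_vertices E} \<subseteq> carrier C"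
  using relation_closed by blast

sublocale L: k_algebra_ideal K C "leavitt_ideal K E"
  by unfold_locales (simp add: leavitt_ideal_eq C.k_ideal_k_ideal_gen relations_subset)

sublocale L_proj: k_algebra_hom K C "leavitt K E" L.coset
  unfolding leavitt_def by (rule L.k_algebra_hom_coset)

lemma leavitt_family: "leavitt_family K (leavitt K E) E (\<lambda>t. L.coset (C_elem t))"
proof unfold_locales
  show "L.coset (C_elem GZero) = \<zero>\<^bsub>leavitt K E\<^esub>"
    by (simp add: C_elem_GZero)
next
  fix v assume v: "v \<in> regular_vertices E"
  let ?x = "C_elem (idem (vertex_path v))"
  have "?x \<ominus>\<^bsub>C\<^esub> C_sum v \<in> leavitt_ideal K E"
    using C.k_ideal_gen_superset[OF relations_subset] v unfolding leavitt_ideal_eq by blast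
  then have "L.coset ?x = L.coset (C_sum v)"
    by (simp add: L.coset_eq_iff_minus C_elem_closed)
  also have "\<dots> = (\<Oplus>\<^bsub>leavitt K E\<^esub>e\<in>out_arcs E v. L.coset (C_elem (idem (edge_path E e))))"
    using v by (simp add: L_proj.hom_finsum C_elem_closed regular_vertices_def)
  finally show "L.coset ?x = \<dots>" .
qed (simp_all add: C_elem_closed C_elem_mult L_proj.hom_mult L_proj.hom_closed)

end

section \<open>The algebra maps induced by a regular homomorphism\<close>

locale path_algebra_hom = K: cring K + regular_ext_path_hom E F \<phi>
  for K :: "('k, 'm) ring_scheme" (structure) and E :: "('v, 'e) pre_digraph"
    and F :: "('w, 'f) pre_digraph" and \<phi>
begin

sublocale E: path_algebra K E
  by unfold_locales

sublocale F: path_algebra K F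
  by unfold_locales

sublocale S: semigroup_alg_hom K "gis E" "gis F" \<phi>
  by unfold_locales (auto simp: hom_def map_closed map_mult)

sublocale KS: k_algebra_quotient_hom K E.S.KS F.S.KS S.KS_map "zero_span K E" "zero_span K F"
proof -
  interpret KS: k_algebra_hom K E.S.KS F.S.KS S.KS_map
    by (rule S.k_algebra_hom_KS_map)
  show "k_algebra_quotient_hom K E.S.KS F.S.KS S.KS_map (zero_span K E) (zero_span K F)"
  proof
    fix x assume "x \<in> zero_span K E"
    then obtain c where "c \<in> carrier K" "x = c \<odot>\<^bsub>E.S.KS\<^esub> E.S.bas GZero"
      by (auto simp: zero_span_def)
    then have "S.KS_map x = c \<odot>\<^bsub>F.S.KS\<^esub> F.S.bas GZero"
      by (simp add: KS.hom_smult E.S.basis_in S.KS_map_basis)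
    with \<open>c \<in> carrier K\<close> show "S.KS_map x \<in> zero_span K F"
      by (auto simp: zero_span_def)
  qed
qed

lemma cohn_map_C_elem:
  "t \<in> carrier (gis E) \<Longrightarrow> cohn_map K E F \<phi> (E.C_elem t) = F.C_elem (\<phi> t)"
  by (simp add: cohn_map_def cohn_elem_def KS.quotient_map_coset E.S.basis_in S.KS_map_basis)

sublocale C: k_algebra_hom K E.C F.C "cohn_map K E F \<phi>"
  unfolding cohn_map_def cohn_def by (rule KS.k_algebra_hom_quotient_map)

text \<open>The image of the relation at u need not be a generator for \<open>F\<close>. That it
  lies in the ideal is an equality in the Leavitt algebra of \<open>F\<close>, namely
  \<open>T_regular_hom\<close> for the family of classes there.\<close>

lemma cohn_map_relation:
  assumes u: "u \<in> regular_vertices E"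
  shows "cohn_map K E F \<phi> (E.C_elem (idem (vertex_path u)) \<ominus>\<^bsub>E.C\<^esub> E.C_sum u) \<in> leavitt_ideal K F"
proof -
  let ?s = "\<Oplus>\<^bsub>F.C\<^esub>e\<in>out_arcs E u. F.C_elem (\<phi> (idem (edge_path E e)))"
  let ?x = "F.C_elem (\<phi> (idem (vertex_path u)))"
  have fin: "finite (out_arcs E u)"
    using u by (simp add: regular_vertices_def)
  have s: "?s \<in> carrier F.C"
    by (intro F.C.M.finsum_closed F.C_elem_closed Pi_I)
  have "cohn_map K E F \<phi> (E.C_sum u)
      = (\<Oplus>\<^bsub>F.C\<^esub>e\<in>out_arcs E u. cohn_map K E F \<phi> (E.C_elem (idem (edge_path E e))))"
    using fin by (intro C.hom_finsum) (simp_all add: E.C_elem_closed)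
  also have "\<dots> = ?s"
    by (intro F.C.M.finsum_cong' refl cohn_map_C_elem dom.idem_edge_in_gis Pi_I F.C_elem_closed)
  finally have map_sum: "cohn_map K E F \<phi> (E.C_sum u) = ?s" .
  have "F.L.coset ?x = F.L.coset ?s"
    using leavitt_family.T_regular_hom[OF F.leavitt_family regular_ext_path_hom_axioms u]
    by (simp add: F.L_proj.hom_finsum[OF fin] F.C_elem_closed)
  then have "?x \<ominus>\<^bsub>F.C\<^esub> ?s \<in> leavitt_ideal K F"
    using s by (simp add: F.L.coset_eq_iff_minus F.C_elem_closed)
  then show ?thesis
    using map_sum cohn_map_C_elem[OF dom.idem_vertex_in_gis[OF u]]
    by (simp add: C.hom_minus E.C_elem_closed E.C.M.finsum_closed)
qed

sublocale L: k_algebra_quotient_hom K E.C F.C "cohn_map K E F \<phi>" "leavitt_ideal K E" "leavitt_ideal K F"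
proof
  fix x assume "x \<in> leavitt_ideal K E"
  moreover have "cohn_map K E F \<phi> ` leavitt_ideal K E \<subseteq> leavitt_ideal K F"
    unfolding E.leavitt_ideal_eq
    using cohn_map_relation
    by (intro C.image_k_ideal_gen_subset[OF F.L.ideal E.relations_subset]) blast
  ultimately show "cohn_map K E F \<phi> x \<in> leavitt_ideal K F"
    by blast
qed

lemma leavitt_map_in_homs: "leavitt_map K E F \<phi> \<in> k_algebra_homs K (leavitt K E) (leavitt K F)"
  unfolding leavitt_map_def leavitt_def
  using L.k_algebra_hom_quotient_map quotient_map_extensional
  by (rule k_algebra_hom.extensional_in_k_algebra_homs)

end

context path_algebra
begin

lemma cohn_map_ident:
  "cohn_map K E E (\<lambda>t \<in> carrier (gis E). t) = (\<lambda>x \<in> carrier C. x)"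
  unfolding cohn_map_def cohn_def
proof (rule KS.quotient_map_ident)
  let ?i = "\<lambda>t \<in> carrier (gis E). t"
  interpret S: semigroup_alg_hom K "gis E" "gis E" ?i
    by unfold_locales (auto simp: hom_def gis_mult_closed)
  fix x assume x: "x \<in> carrier S.KS"
  have "k_algebra_hom K S.KS S.KS (\<lambda>x. x)"
    by unfold_locales (simp_all add: KS.mult_closed)
  from S.k_algebra_hom_KS_eqI[OF S.k_algebra_hom_KS_map this _ x]
  show "S.KS_map x = x"
    by (simp add: S.KS_map_basis)
qed

lemma leavitt_map_ident:
  "leavitt_map K E E (\<lambda>t \<in> carrier (gis E). t) = (\<lambda>x \<in> carrier (leavitt K E). x)"
  unfolding leavitt_map_def leavitt_def by (rule L.quotient_map_ident) (simp add: cohn_map_ident)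

end

lemma leavitt_map_compose:
  assumes "path_algebra_hom K E F \<phi>" "path_algebra_hom K F G \<psi>"
  shows "leavitt_map K E G (compose (carrier (gis E)) \<psi> \<phi>)
    = compose (carrier (leavitt K E)) (leavitt_map K F G \<psi>) (leavitt_map K E F \<phi>)"
proof -
  interpret \<phi>: path_algebra_hom K E F \<phi> by fact
  interpret \<psi>: path_algebra_hom K F G \<psi> by fact
  let ?\<chi> = "compose (carrier (gis E)) \<psi> \<phi>"
  interpret \<chi>: path_algebra_hom K E G ?\<chi>
    using regular_ext_path_hom_compose \<phi>.K.is_cring \<phi>.regular_ext_path_hom_axioms
      \<psi>.regular_ext_path_hom_axioms by (simp add: path_algebra_hom_def)
  \<comment> \<open>Both sides are algebra homomorphisms on the semigroup algebra, so they need
    comparing on basis elements only.\<close>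
  have "\<chi>.S.KS_map x = \<psi>.S.KS_map (\<phi>.S.KS_map x)" if "x \<in> carrier \<phi>.E.S.KS" for x
    using that
    by (rule \<phi>.E.S.k_algebra_hom_KS_eqI[OF \<chi>.KS.k_algebra_hom_axioms
          \<phi>.KS.k_algebra_hom_comp[OF \<psi>.KS.k_algebra_hom_axioms], rotated])
      (simp add: \<chi>.S.KS_map_basis \<phi>.S.KS_map_basis \<psi>.S.KS_map_basis \<phi>.map_closed compose_eq)
  then have "cohn_map K E G ?\<chi>
      = compose (carrier \<phi>.E.C) (cohn_map K F G \<psi>) (cohn_map K E F \<phi>)"
    unfolding cohn_map_def cohn_def
    by (rule quotient_map_compose[OF \<phi>.KS.k_algebra_quotient_hom_axioms
          \<psi>.KS.k_algebra_quotient_hom_axioms])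
  then show ?thesis
    unfolding leavitt_map_def leavitt_def
    by (intro quotient_map_compose[OF \<phi>.L.k_algebra_quotient_hom_axioms
          \<psi>.L.k_algebra_quotient_hom_axioms]) (simp add: compose_eq)
qed

theorem theorem4p9:
  fixes K :: "('k, 'm) ring_scheme"
  assumes "field K"
  shows "(\<forall>(E :: ('v, 'e) pre_digraph) \<in> Ob REG. \<forall>F \<in> Ob REG. \<forall>\<phi> \<in> Mor REG E F.
            \<forall>a \<in> carrier (cohn K E).
              leavitt_map K E F \<phi> (leavitt_ideal K E +>\<^bsub>cohn K E\<^esub> a)
                = leavitt_ideal K F +>\<^bsub>cohn K F\<^esub> cohn_map K E F \<phi> a)
       \<and> covariant_functor (REG :: (('v, 'e) pre_digraph, _) category_data) (k_Alg K)
            (leavitt K) (leavitt_map K)"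
proof -
  interpret K: field K by fact
  have hom: "path_algebra_hom K E F \<phi>" if "E \<in> Ob REG" "F \<in> Ob REG" "\<phi> \<in> Mor REG E F"
    for E F :: "('v, 'e) pre_digraph" and \<phi>
    using that K.is_cring by (simp add: path_algebra_hom_def Mor_REG_iff)
  have alg: "path_algebra K E" if "E \<in> Ob REG" for E :: "('v, 'e) pre_digraph"
    using that K.is_cring by (simp add: path_algebra_def REG_def)
  interpret REG: category "REG :: (('v, 'e) pre_digraph, _) category_data"
    by (rule category_REG)
  interpret k_Alg: category "k_Alg K :: (('k, (('v, 'e) gis \<Rightarrow> 'k) set set) module, _) category_data"
    by (rule category_k_Alg)
  \<comment> \<open>Independence of the representative, which gives the definition of
    \<open>leavitt_map\<close> through \<open>the_elem\<close> its intended meaning.\<close>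
  have "leavitt_map K E F \<phi> (leavitt_ideal K E +>\<^bsub>cohn K E\<^esub> a)
      = leavitt_ideal K F +>\<^bsub>cohn K F\<^esub> cohn_map K E F \<phi> a"
    if "E \<in> Ob REG" "F \<in> Ob REG" "\<phi> \<in> Mor REG E F" "a \<in> carrier (cohn K E)"
    for E F :: "('v, 'e) pre_digraph" and \<phi> a
  proof -
    interpret path_algebra_hom K E F \<phi>
      using that by (intro hom)
    show ?thesis
      using that(4) unfolding leavitt_map_def by (rule L.quotient_map_coset)
  qed
  moreover have "covariant_functor (REG :: (('v, 'e) pre_digraph, _) category_data) (k_Alg K)
      (leavitt K) (leavitt_map K)"
  proof
    fix E :: "('v, 'e) pre_digraph"
    assume "E \<in> Ob REG"
    then interpret path_algebra K E
      by (rule alg)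
    show "leavitt K E \<in> Ob (k_Alg K)"
      using L.k_algebra_k_quotient by (simp add: k_Alg_def leavitt_def)
    show "leavitt_map K E E (Ident REG E) = Ident (k_Alg K) (leavitt K E)"
      using leavitt_map_ident by (simp add: REG_def k_Alg_def)
  next
    fix E F :: "('v, 'e) pre_digraph" and \<phi>
    assume "E \<in> Ob REG" "F \<in> Ob REG" "\<phi> \<in> Mor REG E F"
    then interpret path_algebra_hom K E F \<phi>
      by (rule hom)
    show "leavitt_map K E F \<phi> \<in> Mor (k_Alg K) (leavitt K E) (leavitt K F)"
      using leavitt_map_in_homs by (simp add: k_Alg_def)
  next
    fix E F G :: "('v, 'e) pre_digraph" and \<phi> \<psi>
    assume "E \<in> Ob REG" "F \<in> Ob REG" "G \<in> Ob REG" "\<phi> \<in> Mor REG E F" "\<psi> \<in> Mor REG F G"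
    then show "leavitt_map K E G (Comp REG E F G \<psi> \<phi>)
        = Comp (k_Alg K) (leavitt K E) (leavitt K F) (leavitt K G)
            (leavitt_map K F G \<psi>) (leavitt_map K E F \<phi>)"
      using leavitt_map_compose[OF hom[of E F \<phi>] hom[of F G \<psi>]] by (simp add: REG_def k_Alg_def)
  qed
  ultimately show ?thesis
    by blast
qed

end
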